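(* Assume binary sensor messages ($l=2$). For each $m=0,\dots,M-1$, a maximin quantizer $\bar\phi^{\max}_m$ for state $m$ exists, and it can be chosen as a randomization of at most $M-1$ deterministic quantizers. Moreover, if the densities $f_0,\dots,f_{M-1}$ are linearly independent, then $\bar\phi^{\max}_m$ can be chosen as a randomization of at most $M-1$ deterministic unambiguous likelihood quantizers (ULQs).
   Context: Setting: a raw observation $X$ has, under state $m\in\{0,\dots,M-1\}$ (probability $\mathbf P_m$), density $f_m$ with respect to a common $\sigma$-finite measure. Standing assumption: for all $m\neq m'$, $0<\mathbf E_m[\log(f_m(X)/f_{m'}(X))]<\infty$. A deterministic quantizer is a measurable map $\phi$ from the observation space to $\{0,1\}$; $\Phi$ is the set of these. A randomized quantizer $\bar\phi=\sum_j p^j\phi^j$ is a probability distribution $(p^j)$ on a countable set $\{\phi^j\}\subset\Phi$; deterministic quantizers are identified with randomized ones of mass one; $\bar\Phi$ is the set of all quantizers. For $\phi\in\Phi$, $f_m(u;\phi)=\mathbf P_m(\phi(X)=u)$ and $I(m,m';\phi)=\sum_{u}f_m(u;\phi)\log\frac{f_m(u;\phi)}{f_{m'}(u;\phi)}$; for $\bar\phi=\sum_jp^j\phi^j$, $I(m,m';\bar\phi)=\sum_jp^jI(m,m';\phi^j)$; $I(m;\bar\phi)=\min_{m'\neq m}I(m,m';\bar\phi)$; $I(m)=\sup_{\bar\phi\in\bar\Phi}I(m;\bar\phi)$; a maximin quantizer for state $m$ is a $\bar\phi\in\bar\Phi$ with $I(m;\bar\phi)=I(m)$. A deterministic quantizer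 $\phi$ is an unambiguous likelihood quantizer (ULQ) if there are reals $a_0,\dots,a_{M-1}$ with $\phi(X)=\mathbf 1\{\sum_m a_mf_m(X)>0\}$ and $\mathbf P_{m'}\{\sum_m a_mf_m(X)=0\}=0$ for every $m'$. The densities $f_0,\dots,f_{M-1}$ are linearly independent if $\mathbf P_{m'}\{\sum_ma_mf_m(X)=0\}=0$ for every $m'$ and every $(a_0,\dots,a_{M-1})$ not all zero. *)

theory Defs
  imports "HOL-Probability.Probability"
begin

text \<open>Raw observation X lives in the measure space N (the common sigma-finite
measure); f m is the density of X under state m; states are 0..M-1.
Binary sensor messages (l = 2) are represented by bool.\<close>

definition Pm :: "'a measure \<Rightarrow> (nat \<Rightarrow> 'a \<Rightarrow> real) \<Rightarrow> nat \<Rightarrow> 'a measure" where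
  "Pm N f m = density N (\<lambda>x. ennreal (f m x))"

definition det_quantizer :: "'a measure \<Rightarrow> ('a \<Rightarrow> bool) \<Rightarrow> bool" where
  "det_quantizer N \<phi> \<longleftrightarrow> \<phi> \<in> N \<rightarrow>\<^sub>M count_space UNIV"

definition rand_quantizer :: "'a measure \<Rightarrow> ('a \<Rightarrow> bool) pmf \<Rightarrow> bool" where
  "rand_quantizer N Q \<longleftrightarrow> (\<forall>\<phi>\<in>set_pmf Q. det_quantizer N \<phi>)"

definition qprob :: "'a measure \<Rightarrow> (nat \<Rightarrow> 'a \<Rightarrow> real) \<Rightarrow> nat \<Rightarrow> ('a \<Rightarrow> bool) \<Rightarrow> bool \<Rightarrow> real" where
  "qprob N f m \<phi> u = measure (Pm N f m) {x \<in> space N. \<phi> x = u}"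

definition klterm :: "real \<Rightarrow> real \<Rightarrow> real" where
  "klterm p q = (if p = 0 then 0 else p * ln (p / q))"

definition Idet :: "'a measure \<Rightarrow> (nat \<Rightarrow> 'a \<Rightarrow> real) \<Rightarrow> nat \<Rightarrow> nat \<Rightarrow> ('a \<Rightarrow> bool) \<Rightarrow> real" where
  "Idet N f m m' \<phi> = (\<Sum>u\<in>UNIV. klterm (qprob N f m \<phi> u) (qprob N f m' \<phi> u))"

definition Irand :: "'a measure \<Rightarrow> (nat \<Rightarrow> 'a \<Rightarrow> real) \<Rightarrow> nat \<Rightarrow> nat \<Rightarrow> ('a \<Rightarrow> bool) pmf \<Rightarrow> real" where
  "Irand N f m m' Q = measure_pmf.expectation Q (Idet N f m m')"

definition Imin :: "'a measure \<Rightarrow> (nat \<Rightarrow> 'a \<Rightarrow> real) \<Rightarrow> nat \<Rightarrow> nat \<Rightarrow> ('a \<Rightarrow> bool) pmf \<Rightarrow> real" where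
  "Imin N f M m Q = Min {Irand N f m m' Q | m'. m' < M \<and> m' \<noteq> m}"

definition Isup :: "'a measure \<Rightarrow> (nat \<Rightarrow> 'a \<Rightarrow> real) \<Rightarrow> nat \<Rightarrow> nat \<Rightarrow> real" where
  "Isup N f M m = (SUP Q \<in> {Q. rand_quantizer N Q}. Imin N f M m Q)"

definition maximin :: "'a measure \<Rightarrow> (nat \<Rightarrow> 'a \<Rightarrow> real) \<Rightarrow> nat \<Rightarrow> nat \<Rightarrow> ('a \<Rightarrow> bool) pmf \<Rightarrow> bool" where
  "maximin N f M m Q \<longleftrightarrow> rand_quantizer N Q \<and> Imin N f M m Q = Isup N f M m"

definition ULQ :: "'a measure \<Rightarrow> (nat \<Rightarrow> 'a \<Rightarrow> real) \<Rightarrow> nat \<Rightarrow> ('a \<Rightarrow> bool) \<Rightarrow> bool" where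
  "ULQ N f M \<phi> \<longleftrightarrow> det_quantizer N \<phi> \<and>
     (\<exists>a :: nat \<Rightarrow> real.
        (\<forall>x\<in>space N. \<phi> x = ((\<Sum>k<M. a k * f k x) > 0)) \<and>
        (\<forall>m'<M. emeasure (Pm N f m') {x \<in> space N. (\<Sum>k<M. a k * f k x) = 0} = 0))"

definition lin_indep_dens :: "'a measure \<Rightarrow> (nat \<Rightarrow> 'a \<Rightarrow> real) \<Rightarrow> nat \<Rightarrow> bool" where
  "lin_indep_dens N f M \<longleftrightarrow>
     (\<forall>a :: nat \<Rightarrow> real. (\<exists>k<M. a k \<noteq> 0) \<longrightarrow>
        (\<forall>m'<M. emeasure (Pm N f m') {x \<in> space N. (\<Sum>k<M. a k * f k x) = 0} = 0))"

end

theory Submission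
  imports Defs
begin

text \<open>
A test is a measurable function with values in \<open>[0,1]\<close>. The vector of its integrals against
finitely many integrable functions may be approached without being attained by a deterministic
quantizer, but every limit of such vectors is the mean of a finite mixture of vectors of
deterministic quantizers: otherwise a linear functional separates the limit from them, the tests
asymptotically maximize this functional and hence converge to a likelihood quantizer off its ties,
and on the ties the functions are linearly dependent, so that there are fewer of them to consider.
If the densities are linearly independent, there are no ties and likelihood quantizers suffice.

The divergences are convex in the error probabilities. They are also continuous along sequences of
tests, since near a degenerate pair the log-sum inequality bounds them by the integrals of the tests
against one integrable function. By an argument of Caratheodory, \<open>M - 1\<close> atoms suffice to match or
exceed the \<open>M - 1\<close> divergences of any mixture. In a maximizing sequence of mixtures of \<open>M - 1\<close>
quantizers, the weights and the error probabilities of the atoms converge along a subsequence.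
Replacing the limit of each atom by a finite mixture of quantizers does not decrease any divergence,
and a second reduction to \<open>M - 1\<close> atoms yields a maximin quantizer.
\<close>

section \<open>Finitely supported distributions\<close>

definition finite_pmfs :: "'a set \<Rightarrow> 'a pmf set" where
  "finite_pmfs A = {q. finite (set_pmf q) \<and> set_pmf q \<subseteq> A}"

lemma finite_pmfsI: "finite A \<Longrightarrow> set_pmf q \<subseteq> A \<Longrightarrow> q \<in> finite_pmfs A"
  by (auto simp: finite_pmfs_def intro: finite_subset)

lemma return_pmf_in_finite_pmfs: "x \<in> A \<Longrightarrow> return_pmf x \<in> finite_pmfs A"
  by (simp add: finite_pmfs_def)

lemma map_pmf_in_finite_pmfs:
  assumes "q \<in> finite_pmfs A" and "f ` A \<subseteq> B"
  shows "map_pmf f q \<in> finite_pmfs B"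
  using assms by (auto simp: finite_pmfs_def)

lemma bind_pmf_in_finite_pmfs:
  assumes "q \<in> finite_pmfs A" and "\<And>x. x \<in> A \<Longrightarrow> r x \<in> finite_pmfs B"
  shows "bind_pmf q r \<in> finite_pmfs B"
  using assms by (fastforce simp: finite_pmfs_def)

lemma expectation_bind_finite_pmf:
  fixes h :: "'b \<Rightarrow> real"
  assumes "q \<in> finite_pmfs A" and "\<And>x. x \<in> A \<Longrightarrow> r x \<in> finite_pmfs B"
  shows "measure_pmf.expectation (bind_pmf q r) h =
    measure_pmf.expectation q (\<lambda>x. measure_pmf.expectation (r x) h)"
proof -
  have q: "finite (set_pmf q)" and r: "\<And>x. x \<in> set_pmf q \<Longrightarrow> finite (set_pmf (r x))"
    using assms by (auto simp: finite_pmfs_def)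
  then show ?thesis
    by (simp add: pmf_expectation_bind[OF q r order_refl] integral_measure_pmf[OF q])
qed

lemma ex_pmf_with_weights:
  fixes w :: "'a \<Rightarrow> real"
  assumes "finite S" and "\<And>i. i \<in> S \<Longrightarrow> 0 \<le> w i" and "sum w S = 1"
  shows "\<exists>q. set_pmf q \<subseteq> S \<and> (\<forall>i\<in>S. pmf q i = w i)"
proof -
  define u where "u i = (if i \<in> S then w i else 0)" for i
  have nonneg: "0 \<le> u i" for i
    using assms(2) by (simp add: u_def)
  have "(\<integral>\<^sup>+i. ennreal (u i) \<partial>count_space UNIV) = (\<Sum>i\<in>S. ennreal (u i))"
    using assms(1) by (intro nn_integral_count_space') (auto simp: u_def)
  also have "\<dots> = ennreal (\<Sum>i\<in>S. u i)"
    using nonneg by (intro sum_ennreal) auto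
  also have "(\<Sum>i\<in>S. u i) = 1"
    using assms(3) by (simp add: u_def)
  finally have "(\<integral>\<^sup>+i. ennreal (u i) \<partial>count_space UNIV) = 1" by simp
  with nonneg have "pmf (embed_pmf u) i = u i" for i
    by (rule pmf_embed_pmf)
  then show ?thesis
    by (intro exI[of _ "embed_pmf u"]) (auto simp: u_def set_pmf_iff split: if_splits)
qed

lemma finite_pmf_enumeration:
  assumes "finite (set_pmf q)" and "card (set_pmf q) \<le> R"
  shows "\<exists>t x. set_pmf t \<subseteq> {..<R} \<and> range x \<subseteq> set_pmf q \<and> q = map_pmf x t"
proof -
  let ?S = "set_pmf q"
  have "set_pmf (map_pmf (to_nat_on ?S) q) \<subseteq> {..<R}"
    using to_nat_on_finite[OF assms(1)] assms(2) by (auto simp: bij_betw_def)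
  moreover have "range (from_nat_into ?S) \<subseteq> ?S"
    by (rule range_from_nat_into_subset) (rule set_pmf_not_empty)
  moreover have "q = map_pmf (from_nat_into ?S) (map_pmf (to_nat_on ?S) q)"
  proof -
    have "map_pmf (from_nat_into ?S \<circ> to_nat_on ?S) q = map_pmf id q"
      by (rule map_pmf_cong) simp_all
    then show ?thesis
      by (simp add: pmf.map_comp pmf.map_id)
  qed
  ultimately show ?thesis
    by blast
qed

section \<open>Barycenters with few atoms\<close>

definition coordinatewise_convex :: "('j \<Rightarrow> real) set \<Rightarrow> bool" where
  "coordinatewise_convex C \<longleftrightarrow>
    (\<forall>u\<in>C. \<forall>v\<in>C. \<forall>t\<in>{0..1}. (\<lambda>j. t * u j + (1 - t) * v j) \<in> C)"

lemma coordinatewise_convex_crossing: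
  assumes "coordinatewise_convex C" and "p \<in> C" "0 < p i" and "n \<in> C" "n i < 0"
  shows "(\<lambda>j. (p i * n j - n i * p j) / (p i - n i)) \<in> C"
proof -
  define t where "t = - n i / (p i - n i)"
  have t: "t \<in> {0..1}" "1 - t = p i / (p i - n i)"
    using assms(3,5) by (auto simp: t_def field_simps)
  have "(\<lambda>j. t * p j + (1 - t) * n j) \<in> C"
    using assms(1,2,4) t(1) by (auto simp: coordinatewise_convex_def)
  also have "(\<lambda>j. t * p j + (1 - t) * n j) = (\<lambda>j. (p i * n j - n i * p j) / (p i - n i))"
    unfolding t(2) by (simp add: t_def diff_divide_distrib)
  finally show ?thesis .
qed

text \<open>The new coefficient has to separate the quotients of the vectors with negative coordinate
  \<open>i\<close> from those of the vectors with positive coordinate \<open>i\<close>.\<close>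

lemma halfspace_extend_coordinate:
  assumes C: "coordinatewise_convex C" and pos: "p \<in> C" "0 < p i" and neg: "n \<in> C" "n i < 0"
    and slice: "\<And>c. c \<in> C \<Longrightarrow> c i = 0 \<Longrightarrow> (\<Sum>j\<in>J. a j * c j) \<le> 0"
  shows "\<exists>b. \<forall>c\<in>C. (\<Sum>j\<in>J. a j * c j) + b * c i \<le> 0"
proof -
  define L where "L c = (\<Sum>j\<in>J. a j * c j)" for c
  define b where "b = (SUP n\<in>{c \<in> C. c i < 0}. L n / - n i)"
  have quotients: "L n / - n i \<le> - L p / p i" if "p \<in> C" "0 < p i" "n \<in> C" "n i < 0" for p n
  proof -
    have "L (\<lambda>j. (p i * n j - n i * p j) / (p i - n i)) = (p i * L n - n i * L p) / (p i - n i)"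
      by (simp add: L_def sum_distrib_left sum_subtractf right_diff_distrib mult.left_commute
          flip: sum_divide_distrib)
    then have "(p i * L n - n i * L p) / (p i - n i) \<le> 0"
      using slice[OF coordinatewise_convex_crossing[OF C that]] by (simp add: L_def)
    then have "p i * L n \<le> n i * L p"
      using that by (simp add: divide_le_0_iff)
    then show ?thesis using that by (simp add: field_simps)
  qed
  have bdd: "bdd_above ((\<lambda>n. L n / - n i) ` {c \<in> C. c i < 0})"
    using quotients[OF pos] by (intro bdd_aboveI2[where M = "- L p / p i"]) blast
  have "L c + b * c i \<le> 0" if "c \<in> C" for c
  proof (cases "c i" "0 :: real" rule: linorder_cases)
    case less
    have "L c / - c i \<le> b"
      unfolding b_def using that less by (intro cSUP_upper bdd) simp
    with less show ?thesis by (simp add: field_simps)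
  next
    case equal
    with that slice show ?thesis by (simp add: L_def)
  next
    case greater
    have "b \<le> - L c / c i"
      unfolding b_def using quotients[OF that greater] neg by (intro cSUP_least) blast+
    with greater show ?thesis by (simp add: field_simps)
  qed
  then show ?thesis unfolding L_def by blast
qed

lemma sum_insert_fun_upd_mult:
  fixes a c :: "'j \<Rightarrow> real"
  assumes "finite J" and "i \<notin> J"
  shows "(\<Sum>j\<in>insert i J. (a(i := b)) j * c j) = (\<Sum>j\<in>J. a j * c j) + b * c i"
proof -
  have "(\<Sum>j\<in>J. (a(i := b)) j * c j) = (\<Sum>j\<in>J. a j * c j)"
    using assms(2) by (intro sum.cong) auto
  then show ?thesis using assms by simp
qed

lemma convex_contains_zero_or_halfspace:
  fixes C :: "('j \<Rightarrow> real) set"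
  assumes "finite J" and "C \<noteq> {}" and "coordinatewise_convex C"
  shows "(\<exists>c\<in>C. \<forall>j\<in>J. c j = 0) \<or>
    (\<exists>a. (\<exists>j\<in>J. a j \<noteq> 0) \<and> (\<forall>c\<in>C. (\<Sum>j\<in>J. a j * c j) \<le> 0))"
  using assms
proof (induction J arbitrary: C rule: finite_induct)
  case empty
  then show ?case by auto
next
  case (insert i J)
  have halfspaceI: "?case" if "\<exists>j\<in>insert i J. (a(i := b)) j \<noteq> 0"
    and "\<forall>c\<in>C. (\<Sum>j\<in>J. a j * c j) + b * c i \<le> 0" for a b
    using that sum_insert_fun_upd_mult[OF insert.hyps]
    by (intro disjI2 exI[of _ "a(i := b)"]) (simp only: simp_thms)
  consider (nonpos) "\<forall>c\<in>C. c i \<le> 0" | (nonneg) "\<forall>c\<in>C. 0 \<le> c i"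
    | (two_sided) p n where "p \<in> C" "0 < p i" "n \<in> C" "n i < 0"
    by (meson not_le)
  then show ?case
  proof cases
    case nonpos
    then show ?thesis by (intro halfspaceI[of "\<lambda>_. 0" 1]) simp_all
  next
    case nonneg
    then show ?thesis by (intro halfspaceI[of "\<lambda>_. 0" "-1"]) simp_all
  next
    case two_sided
    have "coordinatewise_convex {c \<in> C. c i = 0}"
      using insert.prems(2) by (simp add: coordinatewise_convex_def)
    moreover have "{c \<in> C. c i = 0} \<noteq> {}"
      using coordinatewise_convex_crossing[OF insert.prems(2) two_sided] by fastforce
    ultimately consider (zero) "\<exists>c\<in>{c \<in> C. c i = 0}. \<forall>j\<in>J. c j = 0"
      | (halfspace) a where "\<exists>j\<in>J. a j \<noteq> 0"
          "\<forall>c\<in>{c \<in> C. c i = 0}. (\<Sum>j\<in>J. a j * c j) \<le> 0"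
      using insert.IH by meson
    then show ?thesis
    proof cases
      case halfspace
      then obtain b where "\<forall>c\<in>C. (\<Sum>j\<in>J. a j * c j) + b * c i \<le> 0"
        using halfspace_extend_coordinate[OF insert.prems(2) two_sided, where a = a and J = J]
        by auto
      moreover have "\<exists>j\<in>insert i J. (a(i := b)) j \<noteq> 0"
        using halfspace(1) insert.hyps(2) by auto
      ultimately show ?thesis by (intro halfspaceI)
    qed auto
  qed
qed

lemma finite_pmf_or_supporting_halfspace:
  fixes g :: "'j \<Rightarrow> 'x \<Rightarrow> real"
  assumes "finite J" and "X \<noteq> {}"
  shows "(\<exists>q\<in>finite_pmfs X. \<forall>j\<in>J. measure_pmf.expectation q (g j) = v j) \<or>
    (\<exists>a. (\<exists>j\<in>J. a j \<noteq> 0) \<and> (\<forall>x\<in>X. (\<Sum>j\<in>J. a j * g j x) \<le> (\<Sum>j\<in>J. a j * v j)))"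
proof -
  define dev where "dev q j = measure_pmf.expectation q (g j) - v j" for q j
  have return_mem: "return_pmf x \<in> finite_pmfs X" if "x \<in> X" for x
    using that by (rule return_pmf_in_finite_pmfs)
  then have "dev ` finite_pmfs X \<noteq> {}"
    using assms(2) by blast
  moreover have "coordinatewise_convex (dev ` finite_pmfs X)"
    unfolding coordinatewise_convex_def
  proof (intro ballI, elim imageE)
    fix u v t q r assume t: "t \<in> {0..1 :: real}" and q: "q \<in> finite_pmfs X" "u = dev q"
      and r: "r \<in> finite_pmfs X" "v = dev r"
    define p where "p = bind_pmf (bernoulli_pmf t) (\<lambda>b. if b then q else r)"
    have coin: "bernoulli_pmf t \<in> finite_pmfs UNIV"
      by (simp add: finite_pmfs_def)
    have "p \<in> finite_pmfs X"
      unfolding p_def using q r by (intro bind_pmf_in_finite_pmfs[OF coin]) auto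
    moreover have "(\<lambda>j. t * u j + (1 - t) * v j) = dev p"
      unfolding p_def dev_def q(2) r(2) using q r t
      by (subst expectation_bind_finite_pmf[OF coin, where B = X]) (auto simp: algebra_simps)
    ultimately show "(\<lambda>j. t * u j + (1 - t) * v j) \<in> dev ` finite_pmfs X" by blast
  qed
  ultimately have "(\<exists>c\<in>dev ` finite_pmfs X. \<forall>j\<in>J. c j = 0) \<or>
    (\<exists>a. (\<exists>j\<in>J. a j \<noteq> 0) \<and> (\<forall>c\<in>dev ` finite_pmfs X. (\<Sum>j\<in>J. a j * c j) \<le> 0))"
    by (rule convex_contains_zero_or_halfspace[OF assms(1)])
  then consider (zero) q where "q \<in> finite_pmfs X" "\<forall>j\<in>J. dev q j = 0"
    | (halfspace) a where "\<exists>j\<in>J. a j \<noteq> 0" "\<And>q. q \<in> finite_pmfs X \<Longrightarrow> (\<Sum>j\<in>J. a j * dev q j) \<le> 0"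
    by blast
  then show ?thesis
  proof cases
    case zero
    then show ?thesis by (auto simp: dev_def)
  next
    case halfspace
    have "(\<Sum>j\<in>J. a j * g j x) \<le> (\<Sum>j\<in>J. a j * v j)" if "x \<in> X" for x
      using halfspace(2)[OF return_mem[OF that]]
      by (simp add: dev_def right_diff_distrib sum_subtractf)
    with halfspace(1) show ?thesis by blast
  qed
qed

lemma sum_mult_eq_imp_coordinate_eq:
  fixes a :: "'j \<Rightarrow> real"
  assumes "finite J" and "i \<in> J" and "a i \<noteq> 0"
    and "(\<Sum>j\<in>J. a j * u j) = (\<Sum>j\<in>J. a j * v j)" and "\<And>j. j \<in> J - {i} \<Longrightarrow> u j = v j"
  shows "u i = v i"
proof -
  have "(\<Sum>j\<in>J - {i}. a j * u j) = (\<Sum>j\<in>J - {i}. a j * v j)"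
    using assms(5) by (intro sum.cong) auto
  with assms(1-4) show ?thesis by (simp add: sum.remove)
qed

lemma (in prob_space) AE_eq_expectation_if_le:
  fixes X :: "'a \<Rightarrow> real"
  assumes "integrable M X" and "AE x in M. X x \<le> expectation X"
  shows "AE x in M. X x = expectation X"
proof -
  have "expectation (\<lambda>x. expectation X - X x) = 0"
    using assms(1) by (simp add: prob_space)
  moreover have "AE x in M. 0 \<le> expectation X - X x"
    using assms(2) by eventually_elim simp
  ultimately have "AE x in M. expectation X - X x = 0"
    using assms(1) by (subst (asm) integral_nonneg_eq_0_iff_AE) auto
  then show ?thesis by eventually_elim simp
qed

text \<open>If the barycenter is not a finite mixture, a supporting functional is almost surely constant,
  which makes one of the functions redundant.\<close>

lemma (in prob_space) expectation_eq_finite_pmf: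
  fixes g :: "'j \<Rightarrow> 'a \<Rightarrow> real"
  assumes "finite J" and "\<And>j. j \<in> J \<Longrightarrow> integrable M (g j)" and "AE x in M. x \<in> A"
  shows "\<exists>q\<in>finite_pmfs A. \<forall>j\<in>J. measure_pmf.expectation q (g j) = expectation (g j)"
  using assms
proof (induction J arbitrary: A rule: finite_psubset_induct)
  case (psubset J)
  have "A \<noteq> {}" using psubset.prems(2) by auto
  then consider (mixture) ?case
    | (halfspace) a where "\<exists>j\<in>J. a j \<noteq> 0"
      "\<And>x. x \<in> A \<Longrightarrow> (\<Sum>j\<in>J. a j * g j x) \<le> (\<Sum>j\<in>J. a j * expectation (g j))"
    using finite_pmf_or_supporting_halfspace[OF psubset.hyps, of A g "\<lambda>j. expectation (g j)"]
    by blast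
  then show ?case
  proof cases
    case halfspace
    then obtain i where i: "i \<in> J" "a i \<noteq> 0" by blast
    define G where "G = (\<lambda>x. \<Sum>j\<in>J. a j * g j x)"
    have G: "integrable M G" "expectation G = (\<Sum>j\<in>J. a j * expectation (g j))"
      using psubset.prems(1) by (simp_all add: G_def)
    have "G x \<le> expectation G" if "x \<in> A" for x
      unfolding G(2) using halfspace(2)[OF that] by (simp add: G_def)
    with psubset.prems(2) have "AE x in M. G x \<le> expectation G"
      by (rule eventually_mono)
    from AE_eq_expectation_if_le[OF G(1) this] psubset.prems(2)
    have "AE x in M. x \<in> {x \<in> A. G x = expectation G}"
      by eventually_elim simp
    then obtain q where q: "q \<in> finite_pmfs {x \<in> A. G x = expectation G}"
      "\<And>j. j \<in> J - {i} \<Longrightarrow> measure_pmf.expectation q (g j) = expectation (g j)"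
      using psubset.IH[of "J - {i}"] psubset.prems(1) i(1) by blast
    have "(\<Sum>j\<in>J. a j * measure_pmf.expectation q (g j)) = measure_pmf.expectation q G"
      using q(1) by (simp add: G_def finite_pmfs_def integrable_measure_pmf_finite)
    also have "\<dots> = measure_pmf.expectation q (\<lambda>_. expectation G)"
      using q(1) by (intro integral_cong_AE) (auto simp: AE_measure_pmf_iff finite_pmfs_def)
    also have "\<dots> = (\<Sum>j\<in>J. a j * expectation (g j))"
      by (simp add: G(2))
    finally have "measure_pmf.expectation q (g i) = expectation (g i)"
      using q(2) by (rule sum_mult_eq_imp_coordinate_eq[where a = a, OF psubset.hyps i])
    with q(2) have "\<forall>j\<in>J. measure_pmf.expectation q (g j) = expectation (g j)" by blast
    moreover have "q \<in> finite_pmfs A" using q(1) by (auto simp: finite_pmfs_def)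
    ultimately show ?thesis by blast
  qed
qed

lemma ex_nonzero_homogeneous_solution:
  fixes g :: "'j \<Rightarrow> 'i \<Rightarrow> real"
  assumes "finite J" and "finite S" and "card J < card S"
  shows "\<exists>c. (\<exists>i\<in>S. c i \<noteq> 0) \<and> (\<forall>j\<in>J. (\<Sum>i\<in>S. c i * g j i) = 0)"
  using assms
proof (induction J arbitrary: S rule: finite_induct)
  case empty
  then have "S \<noteq> {}" by auto
  then show ?case by (intro exI[of _ "\<lambda>_. 1"]) auto
next
  case (insert k J)
  have omit: "\<exists>c. c i = 0 \<and> (\<exists>i'\<in>S. c i' \<noteq> 0) \<and> (\<forall>j\<in>J. (\<Sum>i\<in>S. c i * g j i) = 0)" if "i \<in> S" for i
  proof -
    have "card J < card (S - {i})" using insert.prems insert.hyps that by simp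
    then obtain c where c: "\<exists>i'\<in>S - {i}. c i' \<noteq> 0" "\<forall>j\<in>J. (\<Sum>i'\<in>S - {i}. c i' * g j i') = 0"
      using insert.IH[of "S - {i}"] insert.prems(1) by blast
    have "(\<Sum>i'\<in>S. (c(i := 0)) i' * g j i') = (\<Sum>i'\<in>S - {i}. c i' * g j i')" for j
      using insert.prems(1) that by (simp add: sum.remove)
    with c show ?thesis by (intro exI[of _ "c(i := 0)"]) auto
  qed
  have "S \<noteq> {}" using insert.prems by auto
  then obtain c i where c: "i \<in> S" "c i \<noteq> 0" "\<forall>j\<in>J. (\<Sum>i\<in>S. c i * g j i) = 0"
    using omit by blast
  obtain d where d: "d i = 0" "\<exists>i'\<in>S. d i' \<noteq> 0" "\<forall>j\<in>J. (\<Sum>i\<in>S. d i * g j i) = 0"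
    using omit[OF c(1)] by blast
  define \<gamma> where "\<gamma> = (\<Sum>i\<in>S. c i * g k i)"
  define \<delta> where "\<delta> = (\<Sum>i\<in>S. d i * g k i)"
  show ?case
  proof (cases "\<delta> = 0")
    case True
    with d show ?thesis by (intro exI[of _ d]) (auto simp: \<delta>_def)
  next
    case False
    have "(\<Sum>i\<in>S. (\<delta> * c i - \<gamma> * d i) * g j i) =
        \<delta> * (\<Sum>i\<in>S. c i * g j i) - \<gamma> * (\<Sum>i\<in>S. d i * g j i)" for j
      by (simp add: left_diff_distrib sum_subtractf sum_distrib_left mult.assoc)
    then have "\<forall>j\<in>insert k J. (\<Sum>i\<in>S. (\<delta> * c i - \<gamma> * d i) * g j i) = 0"
      using c(3) d(3) by (simp add: \<gamma>_def \<delta>_def)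
    moreover have "\<exists>i\<in>S. \<delta> * c i - \<gamma> * d i \<noteq> 0"
      using c d(1) False by (intro bexI[of _ i]) auto
    ultimately show ?thesis by (intro exI[of _ "\<lambda>i. \<delta> * c i - \<gamma> * d i"] conjI)
  qed
qed

lemma ex_step_to_orthant_boundary:
  fixes w c :: "'i \<Rightarrow> real"
  assumes "finite S" and "\<And>i. i \<in> S \<Longrightarrow> 0 \<le> w i" and "\<exists>i\<in>S. c i < 0"
  shows "\<exists>s\<ge>0. (\<forall>i\<in>S. 0 \<le> w i + s * c i) \<and> (\<exists>i\<in>S. w i + s * c i = 0)"
proof -
  define D where "D = {i \<in> S. c i < 0}"
  define s where "s = Min ((\<lambda>i. w i / - c i) ` D)"
  have D: "finite D" "D \<noteq> {}" using assms(1,3) by (auto simp: D_def)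
  then have "s \<in> (\<lambda>i. w i / - c i) ` D" unfolding s_def by (intro Min_in) auto
  then obtain i where i: "i \<in> S" "c i < 0" "s = w i / - c i" by (auto simp: D_def)
  then have "0 \<le> s" using assms(2)[OF i(1)] by (simp add: divide_nonneg_neg flip: minus_divide_right)
  moreover have "0 \<le> w j + s * c j" if "j \<in> S" for j
  proof (cases "c j < 0")
    case True
    then have "s \<le> w j / - c j"
      using D(1) that unfolding s_def by (intro Min_le) (auto simp: D_def)
    with True show ?thesis by (simp add: field_simps)
  next
    case False
    with that \<open>0 \<le> s\<close> assms(2) show ?thesis by simp
  qed
  moreover have "w i + s * c i = 0" using i by simp
  ultimately show ?thesis using i(1) by blast
qed

text \<open>Preserving only the total mass and the differences to one function \<open>g l\<close> costs \<open>card J\<close>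
  equations, one less than preserving the total mass and all functions.\<close>

lemma ex_ascent_direction:
  fixes g :: "'j \<Rightarrow> 'i \<Rightarrow> real"
  assumes "finite J" and "J \<noteq> {}" and "finite S" and "card J < card S"
  shows "\<exists>c. (\<exists>i\<in>S. c i < 0) \<and> sum c S = 0 \<and> (\<forall>j\<in>J. 0 \<le> (\<Sum>i\<in>S. c i * g j i))"
proof -
  from assms(2) obtain l where l: "l \<in> J" by blast
  obtain d where d: "\<exists>i\<in>S. d i \<noteq> 0"
    "\<forall>j\<in>J. (\<Sum>i\<in>S. d i * (if j = l then 1 else g j i - g l i)) = 0"
    using ex_nonzero_homogeneous_solution[OF assms(1,3,4),
        of "\<lambda>j i. if j = l then 1 else g j i - g l i"]
    by blast
  define \<sigma> :: real where "\<sigma> = (if 0 \<le> (\<Sum>i\<in>S. d i * g l i) then 1 else -1)"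
  define c where "c i = \<sigma> * d i" for i
  have sum_c: "(\<Sum>i\<in>S. c i * h i) = \<sigma> * (\<Sum>i\<in>S. d i * h i)" for h
    by (simp add: c_def sum_distrib_left mult.assoc)
  have mass: "sum c S = 0" using bspec[OF d(2) l] sum_c[of "\<lambda>_. 1"] by simp
  have "\<exists>i\<in>S. c i \<noteq> 0" using d(1) by (simp add: c_def \<sigma>_def)
  then have "\<exists>i\<in>S. c i < 0"
    using mass sum_nonneg_eq_0_iff[OF assms(3), of c] by (meson not_less)
  moreover have "0 \<le> (\<Sum>i\<in>S. c i * g j i)" if "j \<in> J" for j
  proof -
    have "(\<Sum>i\<in>S. d i * g j i) = (\<Sum>i\<in>S. d i * g l i)"
      using bspec[OF d(2) that] by (cases "j = l") (simp_all add: right_diff_distrib sum_subtractf)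
    then show ?thesis by (simp add: sum_c \<sigma>_def)
  qed
  ultimately show ?thesis using mass by blast
qed

lemma ex_smaller_support_dominating:
  fixes g :: "'j \<Rightarrow> 'i \<Rightarrow> real"
  assumes "finite J" and "J \<noteq> {}" and "finite (set_pmf q)" and "card J < card (set_pmf q)"
  shows "\<exists>q'. set_pmf q' \<subset> set_pmf q \<and>
    (\<forall>j\<in>J. measure_pmf.expectation q (g j) \<le> measure_pmf.expectation q' (g j))"
proof -
  let ?S = "set_pmf q"
  obtain c where c: "\<exists>i\<in>?S. c i < 0" "sum c ?S = 0" "\<And>j. j \<in> J \<Longrightarrow> 0 \<le> (\<Sum>i\<in>?S. c i * g j i)"
    using ex_ascent_direction[OF assms] by blast
  obtain s where s: "0 \<le> s" "\<forall>i\<in>?S. 0 \<le> pmf q i + s * c i" "\<exists>i\<in>?S. pmf q i + s * c i = 0"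
    using ex_step_to_orthant_boundary[OF assms(3) _ c(1), of "pmf q"] by auto
  have "(\<Sum>i\<in>?S. pmf q i + s * c i) = 1"
    using c(2) sum_pmf_eq_1[OF assms(3) order_refl]
    by (simp add: sum.distrib flip: sum_distrib_left)
  then obtain q' where q': "set_pmf q' \<subseteq> ?S" "\<forall>i\<in>?S. pmf q' i = pmf q i + s * c i"
    using ex_pmf_with_weights[OF assms(3), of "\<lambda>i. pmf q i + s * c i"] s(2) by blast
  have "measure_pmf.expectation q (g j) \<le> measure_pmf.expectation q' (g j)" if "j \<in> J" for j
  proof -
    have "measure_pmf.expectation q' (g j) = (\<Sum>i\<in>?S. (pmf q i + s * c i) * g j i)"
      using q' by (subst integral_measure_pmf[OF assms(3)]) auto
    also have "\<dots> = measure_pmf.expectation q (g j) + s * (\<Sum>i\<in>?S. c i * g j i)"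
      by (simp add: integral_measure_pmf[OF assms(3)] distrib_right sum.distrib sum_distrib_left
          mult.assoc)
    finally show ?thesis using s(1) c(3)[OF that] by simp
  qed
  moreover have "set_pmf q' \<subset> ?S" using q' s(3) by (metis pmf_eq_0_set_pmf psubsetI)
  ultimately show ?thesis by blast
qed

lemma ex_pmf_few_atoms_dominating:
  fixes g :: "'j \<Rightarrow> 'i \<Rightarrow> real"
  assumes "finite J" and "J \<noteq> {}" and "\<And>j. j \<in> J \<Longrightarrow> integrable (measure_pmf p) (g j)"
  shows "\<exists>q\<in>finite_pmfs (set_pmf p). card (set_pmf q) \<le> card J \<and>
    (\<forall>j\<in>J. measure_pmf.expectation p (g j) \<le> measure_pmf.expectation q (g j))"
proof -
  define dominating where "dominating q \<longleftrightarrow> q \<in> finite_pmfs (set_pmf p) \<and>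
    (\<forall>j\<in>J. measure_pmf.expectation p (g j) \<le> measure_pmf.expectation q (g j))" for q
  have "\<exists>q\<in>finite_pmfs (set_pmf p).
      \<forall>j\<in>J. measure_pmf.expectation q (g j) = measure_pmf.expectation p (g j)"
    by (rule measure_pmf.expectation_eq_finite_pmf[OF assms(1,3) AE_measure_pmf])
  then have "\<exists>q. dominating q" by (auto simp: dominating_def)
  then obtain q where q: "dominating q"
    and minimal: "\<And>q'. dominating q' \<Longrightarrow> card (set_pmf q) \<le> card (set_pmf q')"
    using ex_has_least_nat[of dominating _ "\<lambda>q. card (set_pmf q)"] by blast
  have "card (set_pmf q) \<le> card J"
  proof (rule ccontr)
    assume "\<not> card (set_pmf q) \<le> card J"
    moreover have fin: "finite (set_pmf q)" using q by (simp add: dominating_def finite_pmfs_def)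
    ultimately obtain q' where q': "set_pmf q' \<subset> set_pmf q"
      "\<And>j. j \<in> J \<Longrightarrow> measure_pmf.expectation q (g j) \<le> measure_pmf.expectation q' (g j)"
      using ex_smaller_support_dominating[OF assms(1,2), of q g] by auto
    have "q' \<in> finite_pmfs (set_pmf p)"
      using q q'(1) by (auto simp: dominating_def finite_pmfs_def intro: finite_subset)
    moreover have "measure_pmf.expectation p (g j) \<le> measure_pmf.expectation q' (g j)"
      if "j \<in> J" for j
      using q q'(2)[OF that] that by (auto simp: dominating_def intro: order_trans)
    ultimately have "dominating q'" by (simp add: dominating_def)
    from minimal[OF this] psubset_card_mono[OF fin q'(1)] show False by simp
  qed
  with q show ?thesis by (auto simp: dominating_def)
qed

section \<open>Limits of randomized tests\<close>

lemma LIMSEQ_if_subseq: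
  fixes X :: "nat \<Rightarrow> 'a::topological_space"
  assumes "\<And>r :: nat \<Rightarrow> nat. strict_mono r \<Longrightarrow>
    \<exists>s :: nat \<Rightarrow> nat. strict_mono s \<and> (\<lambda>n. X (r (s n))) \<longlonglongrightarrow> L"
  shows "X \<longlonglongrightarrow> L"
proof (rule topological_tendstoI, rule ccontr)
  fix U assume U: "open U" "L \<in> U" "\<not> (\<forall>\<^sub>F n in sequentially. X n \<in> U)"
  then have "infinite {n. X n \<notin> U}"
    by (simp add: eventually_cofinite flip: cofinite_eq_sequentially)
  then obtain r :: "nat \<Rightarrow> nat" where r: "strict_mono r" "\<And>n. X (r n) \<notin> U"
    using infinite_enumerate by blast
  obtain s where "(\<lambda>n. X (r (s n))) \<longlonglongrightarrow> L" using assms[OF r(1)] by blast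
  then have "\<forall>\<^sub>F n in sequentially. X (r (s n)) \<in> U" using U(1,2) by (rule topological_tendstoD)
  with r(2) show False by simp
qed

lemma ex_convergent_subseq_finite_family:
  fixes x :: "nat \<Rightarrow> 'i \<Rightarrow> 'a::heine_borel"
  assumes "finite I" and "\<And>i. i \<in> I \<Longrightarrow> bounded (range (\<lambda>n. x n i))"
  shows "\<exists>r l. strict_mono r \<and> (\<forall>i\<in>I. (\<lambda>n. x (r n) i) \<longlonglongrightarrow> l i)"
  using assms
proof (induction I rule: finite_induct)
  case empty
  show ?case by (intro exI[of _ id]) (simp add: strict_mono_def)
next
  case (insert k I)
  then obtain r l where r: "strict_mono r" "\<And>i. i \<in> I \<Longrightarrow> (\<lambda>n. x (r n) i) \<longlonglongrightarrow> l i"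
    by auto
  have "bounded (range (\<lambda>n. x (r n) k))"
    using insert.prems[of k] by (rule bounded_subset) auto
  then obtain b s where s: "strict_mono s" "(\<lambda>n. x (r (s n)) k) \<longlonglongrightarrow> b"
    using bounded_imp_convergent_subsequence[of "\<lambda>n. x (r n) k"] by (auto simp: o_def)
  have "(\<lambda>n. x (r (s n)) i) \<longlonglongrightarrow> (l(k := b)) i" if "i \<in> insert k I" for i
    using that s(2) insert.hyps(2) LIMSEQ_subseq_LIMSEQ[OF r(2) s(1)] by (auto simp: o_def)
  moreover have "strict_mono (\<lambda>n. r (s n))"
    using strict_mono_o[OF r(1) s(1)] by (simp add: o_def)
  ultimately show ?case by blast
qed

lemma ex_convergent_subseq_pmf:
  fixes t :: "nat \<Rightarrow> 'i pmf"
  assumes "finite S" and "\<And>n. set_pmf (t n) \<subseteq> S"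
  shows "\<exists>r s. strict_mono r \<and> set_pmf s \<subseteq> S \<and> (\<forall>i\<in>S. (\<lambda>n. pmf (t (r n)) i) \<longlonglongrightarrow> pmf s i)"
proof -
  have "bounded (range (\<lambda>n. pmf (t n) i))" for i
    by (rule bounded_subset[OF bounded_closed_interval[of 0 1]]) (auto simp: pmf_le_1)
  then obtain r w where r: "strict_mono r" and w: "\<And>i. i \<in> S \<Longrightarrow> (\<lambda>n. pmf (t (r n)) i) \<longlonglongrightarrow> w i"
    using ex_convergent_subseq_finite_family[OF assms(1), of "\<lambda>n i. pmf (t n) i"] by blast
  have "0 \<le> w i" if "i \<in> S" for i
    using w[OF that] by (rule LIMSEQ_le_const) simp
  moreover have "sum w S = 1"
  proof (rule LIMSEQ_unique)
    show "(\<lambda>n. \<Sum>i\<in>S. pmf (t (r n)) i) \<longlonglongrightarrow> sum w S"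
      using w by (intro tendsto_sum)
    show "(\<lambda>n. \<Sum>i\<in>S. pmf (t (r n)) i) \<longlonglongrightarrow> 1"
      using assms by (simp add: sum_pmf_eq_1)
  qed
  ultimately obtain s where s: "set_pmf s \<subseteq> S" "\<And>i. i \<in> S \<Longrightarrow> pmf s i = w i"
    using ex_pmf_with_weights[OF assms(1), of w] by blast
  have "\<forall>i\<in>S. (\<lambda>n. pmf (t (r n)) i) \<longlonglongrightarrow> pmf s i" using w s(2) by simp
  with r s(1) show ?thesis by blast
qed

lemma integrable_bounded_mult:
  fixes u g :: "'a \<Rightarrow> real"
  assumes "u \<in> borel_measurable N" and "\<And>x. x \<in> space N \<Longrightarrow> \<bar>u x\<bar> \<le> 1" and "integrable N g"
  shows "integrable N (\<lambda>x. u x * g x)"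
proof (rule Bochner_Integration.integrable_bound[OF assms(3)])
  show "AE x in N. norm (u x * g x) \<le> norm (g x)"
    using assms(2) by (auto simp: abs_mult mult_left_le_one_le)
qed (use assms in auto)

lemma tendsto_integral_bounded_mult_0:
  fixes u :: "nat \<Rightarrow> 'a \<Rightarrow> real"
  assumes u: "\<And>n. u n \<in> borel_measurable N" "\<And>n x. x \<in> space N \<Longrightarrow> \<bar>u n x\<bar> \<le> 1"
    and w: "integrable N w" and g: "integrable N g" and supp: "AE x in N. w x = 0 \<longrightarrow> g x = 0"
    and lim: "(\<lambda>n. \<integral>x. \<bar>u n x * w x\<bar> \<partial>N) \<longlonglongrightarrow> 0"
  shows "(\<lambda>n. \<integral>x. u n x * g x \<partial>N) \<longlonglongrightarrow> 0"
proof (rule LIMSEQ_if_subseq)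
  fix r :: "nat \<Rightarrow> nat" assume r: "strict_mono r"
  have "(\<lambda>n. \<integral>x. norm (u (r n) x * w x) \<partial>N) \<longlonglongrightarrow> 0"
    using LIMSEQ_subseq_LIMSEQ[OF lim r] by (simp add: o_def)
  then obtain s where s: "strict_mono s" "AE x in N. (\<lambda>n. u (r (s n)) x * w x) \<longlonglongrightarrow> 0"
    using tendsto_L1_AE_subseq[of N "\<lambda>n x. u (r n) x * w x"] integrable_bounded_mult[OF u w]
    by blast
  have "(\<lambda>n. \<integral>x. u (r (s n)) x * g x \<partial>N) \<longlonglongrightarrow> (\<integral>x. 0 \<partial>N)"
  proof (rule integral_dominated_convergence[where w = "\<lambda>x. \<bar>g x\<bar>"])
    show "AE x in N. (\<lambda>n. u (r (s n)) x * g x) \<longlonglongrightarrow> 0"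
      using s(2) supp
    proof eventually_elim
      case (elim x)
      then show ?case
        using tendsto_mult_right[where c = "g x / w x", OF elim(1)] by (cases "w x = 0") simp_all
    qed
    show "AE x in N. norm (u (r (s n)) x * g x) \<le> \<bar>g x\<bar>" for n
      using u(2) by (auto simp: abs_mult mult_left_le_one_le)
  qed (use u g in auto)
  with s(1) show "\<exists>s. strict_mono s \<and> (\<lambda>n. \<integral>x. u (r (s n)) x * g x \<partial>N) \<longlonglongrightarrow> 0" by auto
qed

definition tests :: "'a measure \<Rightarrow> ('a \<Rightarrow> real) set" where
  "tests N = {h \<in> borel_measurable N. \<forall>x\<in>space N. 0 \<le> h x \<and> h x \<le> 1}"

lemma test_measurable: "h \<in> tests N \<Longrightarrow> h \<in> borel_measurable N"
  by (simp add: tests_def)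

lemma test_nonneg: "h \<in> tests N \<Longrightarrow> x \<in> space N \<Longrightarrow> 0 \<le> h x"
  and test_le_1: "h \<in> tests N \<Longrightarrow> x \<in> space N \<Longrightarrow> h x \<le> 1"
  by (simp_all add: tests_def)

lemma test_compl: "h \<in> tests N \<Longrightarrow> (\<lambda>x. 1 - h x) \<in> tests N"
  by (auto simp: tests_def)

lemma of_bool_in_tests: "det_quantizer N \<phi> \<Longrightarrow> (\<lambda>x. of_bool (\<phi> x)) \<in> tests N"
  by (auto simp: det_quantizer_def tests_def)

lemma integrable_test_mult:
  fixes g :: "'a \<Rightarrow> real"
  assumes "h \<in> tests N" and "integrable N g"
  shows "integrable N (\<lambda>x. h x * g x)"
  using assms by (intro integrable_bounded_mult) (auto simp: tests_def)

lemma integral_test_mult_sum: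
  fixes g :: "'j \<Rightarrow> 'a \<Rightarrow> real"
  assumes "h \<in> tests N" and "\<And>j. j \<in> J \<Longrightarrow> integrable N (g j)"
  shows "(\<integral>x. h x * (\<Sum>j\<in>J. a j * g j x) \<partial>N) = (\<Sum>j\<in>J. a j * (\<integral>x. h x * g j x \<partial>N))"
proof -
  have "(\<integral>x. h x * (\<Sum>j\<in>J. a j * g j x) \<partial>N) = (\<integral>x. (\<Sum>j\<in>J. a j * (h x * g j x)) \<partial>N)"
    by (simp add: sum_distrib_left mult.left_commute)
  also have "\<dots> = (\<Sum>j\<in>J. a j * (\<integral>x. h x * g j x \<partial>N))"
    using assms by (simp add: integrable_test_mult)
  finally show ?thesis .
qed

abbreviation accept_integral :: "'a measure \<Rightarrow> ('a \<Rightarrow> real) \<Rightarrow> ('a \<Rightarrow> bool) \<Rightarrow> real" where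
  "accept_integral N g \<phi> \<equiv> \<integral>x. of_bool (\<phi> x) * g x \<partial>N"

abbreviation det_quantizers :: "'a measure \<Rightarrow> ('a \<Rightarrow> bool) set" where
  "det_quantizers N \<equiv> {\<phi>. det_quantizer N \<phi>}"

lemma det_quantizer_pos:
  assumes "G \<in> borel_measurable N"
  shows "det_quantizer N (\<lambda>x. (0 :: real) < G x)"
  using assms unfolding det_quantizer_def by measurable

lemma integral_abs_test_diff:
  fixes G :: "'a \<Rightarrow> real"
  assumes h: "h \<in> tests N" and G: "integrable N G"
  shows "(\<integral>x. \<bar>(h x - of_bool (0 < G x)) * G x\<bar> \<partial>N) =
    accept_integral N G (\<lambda>x. 0 < G x) - (\<integral>x. h x * G x \<partial>N)"
proof -
  have "(\<lambda>x. of_bool (0 < G x)) \<in> tests N"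
    using G by (intro of_bool_in_tests det_quantizer_pos) auto
  note int = integrable_test_mult[OF this G] integrable_test_mult[OF h G]
  have "(\<integral>x. \<bar>(h x - of_bool (0 < G x)) * G x\<bar> \<partial>N) = (\<integral>x. of_bool (0 < G x) * G x - h x * G x \<partial>N)"
  proof (rule Bochner_Integration.integral_cong)
    fix x assume "x \<in> space N"
    with h have "0 \<le> h x" "h x \<le> 1"
      by (auto intro: test_nonneg test_le_1)
    then show "\<bar>(h x - of_bool (0 < G x)) * G x\<bar> = of_bool (0 < G x) * G x - h x * G x"
      by (cases "0 < G x") (simp_all add: abs_mult algebra_simps)
  qed simp
  then show ?thesis using int by simp
qed

lemma integral_test_mult_le:
  fixes G :: "'a \<Rightarrow> real"
  assumes "h \<in> tests N" and "integrable N G"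
  shows "(\<integral>x. h x * G x \<partial>N) \<le> accept_integral N G (\<lambda>x. 0 < G x)"
proof -
  have "0 \<le> (\<integral>x. \<bar>(h x - of_bool (0 < G x)) * G x\<bar> \<partial>N)" by simp
  then show ?thesis unfolding integral_abs_test_diff[OF assms] by simp
qed

lemma test_integral_tendsto_off_zeros:
  fixes G g :: "'a \<Rightarrow> real"
  assumes h: "\<And>n. h n \<in> tests N" and G: "integrable N G" and g: "integrable N g"
    and lim: "(\<lambda>n. \<integral>x. h n x * G x \<partial>N) \<longlonglongrightarrow> accept_integral N G (\<lambda>x. 0 < G x)"
  shows "(\<lambda>n. \<integral>x. h n x * (of_bool (G x \<noteq> 0) * g x) \<partial>N) \<longlonglongrightarrow> accept_integral N g (\<lambda>x. 0 < G x)"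
proof -
  define p where "p x = (of_bool (0 < G x) :: real)" for x
  define g' where "g' x = of_bool (G x \<noteq> 0) * g x" for x
  have [measurable]: "G \<in> borel_measurable N" using G by auto
  have p: "p \<in> tests N"
    unfolding p_def by (intro of_bool_in_tests det_quantizer_pos) measurable
  have [measurable]: "p \<in> borel_measurable N" "h n \<in> borel_measurable N" for n
    using p h by (auto dest: test_measurable)
  have g': "integrable N g'"
    unfolding g'_def using g by (intro integrable_bounded_mult) auto
  have abs_le: "\<bar>h n x - p x\<bar> \<le> 1" if "x \<in> space N" for n x
    using test_nonneg[OF h that, of n] test_le_1[OF h that, of n] by (auto simp: p_def)
  have "(\<lambda>n. \<integral>x. \<bar>(h n x - p x) * G x\<bar> \<partial>N) \<longlonglongrightarrow> 0"
    unfolding p_def integral_abs_test_diff[OF h G]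
    using tendsto_diff[OF tendsto_const[of "accept_integral N G (\<lambda>x. 0 < G x)"] lim] by simp
  then have "(\<lambda>n. \<integral>x. (h n x - p x) * g' x \<partial>N) \<longlonglongrightarrow> 0"
    using abs_le G by (intro tendsto_integral_bounded_mult_0[where w = G] g') (auto simp: g'_def)
  moreover have "(\<integral>x. (h n x - p x) * g' x \<partial>N) = (\<integral>x. h n x * g' x \<partial>N) - (\<integral>x. p x * g' x \<partial>N)" for n
    using integrable_test_mult[OF p g'] integrable_test_mult[OF h g']
    by (simp add: left_diff_distrib)
  ultimately have "(\<lambda>n. (\<integral>x. h n x * g' x \<partial>N) - (\<integral>x. p x * g' x \<partial>N)) \<longlonglongrightarrow> 0" by simp
  then have "(\<lambda>n. \<integral>x. h n x * g' x \<partial>N) \<longlonglongrightarrow> (\<integral>x. p x * g' x \<partial>N)"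
    by (rule LIM_zero_cancel)
  moreover have "(\<integral>x. p x * g' x \<partial>N) = accept_integral N g (\<lambda>x. 0 < G x)"
    by (rule Bochner_Integration.integral_cong) (auto simp: p_def g'_def)
  ultimately show ?thesis by (simp add: g'_def)
qed

lemma supported_test_limit:
  fixes g :: "'j \<Rightarrow> 'a \<Rightarrow> real" and a :: "'j \<Rightarrow> real" and J :: "'j set"
  defines "G \<equiv> \<lambda>x. \<Sum>j\<in>J. a j * g j x"
  assumes g: "\<And>j. j \<in> J \<Longrightarrow> integrable N (g j)" and h: "\<And>n. h n \<in> tests N"
    and lim: "\<And>j. j \<in> J \<Longrightarrow> (\<lambda>n. \<integral>x. h n x * g j x \<partial>N) \<longlonglongrightarrow> v j"
    and supp: "(\<Sum>j\<in>J. a j * accept_integral N (g j) (\<lambda>x. 0 < G x)) \<le> (\<Sum>j\<in>J. a j * v j)"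
  shows "accept_integral N G (\<lambda>x. 0 < G x) = (\<Sum>j\<in>J. a j * v j)"
    and "j \<in> J \<Longrightarrow> (\<lambda>n. \<integral>x. h n x * (of_bool (G x = 0) * g j x) \<partial>N)
      \<longlonglongrightarrow> v j - accept_integral N (g j) (\<lambda>x. 0 < G x)"
proof -
  have G: "integrable N G" using g by (simp add: G_def)
  have integral_G: "(\<integral>x. t x * G x \<partial>N) = (\<Sum>j\<in>J. a j * (\<integral>x. t x * g j x \<partial>N))"
    if "t \<in> tests N" for t
    unfolding G_def using that g by (rule integral_test_mult_sum)
  have lim_G: "(\<lambda>n. \<integral>x. h n x * G x \<partial>N) \<longlonglongrightarrow> (\<Sum>j\<in>J. a j * v j)"
    unfolding integral_G[OF h] by (intro tendsto_sum tendsto_mult_left lim)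
  show max: "accept_integral N G (\<lambda>x. 0 < G x) = (\<Sum>j\<in>J. a j * v j)"
  proof (rule antisym)
    show "accept_integral N G (\<lambda>x. 0 < G x) \<le> (\<Sum>j\<in>J. a j * v j)"
      using supp G integral_G[OF of_bool_in_tests[OF det_quantizer_pos]] by auto
    show "(\<Sum>j\<in>J. a j * v j) \<le> accept_integral N G (\<lambda>x. 0 < G x)"
      using integral_test_mult_le[OF h G] by (intro LIMSEQ_le_const2[OF lim_G]) blast
  qed
  show "(\<lambda>n. \<integral>x. h n x * (of_bool (G x = 0) * g j x) \<partial>N)
      \<longlonglongrightarrow> v j - accept_integral N (g j) (\<lambda>x. 0 < G x)" if j: "j \<in> J"
  proof -
    have "of_bool (G x = 0) * g j x = g j x - of_bool (G x \<noteq> 0) * g j x" for x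
      by simp
    moreover have "integrable N (\<lambda>x. of_bool (G x \<noteq> 0) * g j x)"
      using g[OF j] G by (intro integrable_bounded_mult) auto
    ultimately have "(\<integral>x. h n x * (of_bool (G x = 0) * g j x) \<partial>N) =
        (\<integral>x. h n x * g j x \<partial>N) - (\<integral>x. h n x * (of_bool (G x \<noteq> 0) * g j x) \<partial>N)" for n
      using integrable_test_mult[OF h] g[OF j] by (simp add: right_diff_distrib)
    then show ?thesis
      using tendsto_diff[OF lim[OF j]
          test_integral_tendsto_off_zeros[OF h G g[OF j] lim_G[folded max]]]
      by simp
  qed
qed

lemma expectation_accept_integral_sum:
  fixes g :: "'j \<Rightarrow> 'a \<Rightarrow> real"
  assumes q: "q \<in> finite_pmfs (det_quantizers N)" and g: "\<And>j. j \<in> J \<Longrightarrow> integrable N (g j)"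
  shows "measure_pmf.expectation q (accept_integral N (\<lambda>x. \<Sum>j\<in>J. a j * g j x)) =
    (\<Sum>j\<in>J. a j * measure_pmf.expectation q (accept_integral N (g j)))"
proof -
  have "measure_pmf.expectation q (accept_integral N (\<lambda>x. \<Sum>j\<in>J. a j * g j x)) =
    measure_pmf.expectation q (\<lambda>\<phi>. \<Sum>j\<in>J. a j * accept_integral N (g j) \<phi>)"
    using assms
    by (intro integral_cong_AE)
      (auto simp: AE_measure_pmf_iff finite_pmfs_def intro!: integral_test_mult_sum of_bool_in_tests)
  also have "\<dots> = (\<Sum>j\<in>J. a j * measure_pmf.expectation q (accept_integral N (g j)))"
    using q by (simp add: finite_pmfs_def integrable_measure_pmf_finite)
  finally show ?thesis .
qed

definition tie_break :: "('a \<Rightarrow> real) \<Rightarrow> ('a \<Rightarrow> bool) \<Rightarrow> 'a \<Rightarrow> bool" where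
  "tie_break G \<phi> x \<longleftrightarrow> 0 < G x \<or> G x = 0 \<and> \<phi> x"

lemma det_quantizer_tie_break:
  assumes "G \<in> borel_measurable N" and "det_quantizer N \<phi>"
  shows "det_quantizer N (tie_break G \<phi>)"
  using assms unfolding det_quantizer_def tie_break_def by measurable

lemma accept_integral_tie_break:
  fixes g :: "'a \<Rightarrow> real"
  assumes G: "G \<in> borel_measurable N" and \<phi>: "det_quantizer N \<phi>" and g: "integrable N g"
  shows "accept_integral N g (tie_break G \<phi>) =
    accept_integral N g (\<lambda>x. 0 < G x) + accept_integral N (\<lambda>x. of_bool (G x = 0) * g x) \<phi>"
proof -
  have "integrable N (\<lambda>x. of_bool (G x = 0) * g x)"
    using G g by (intro integrable_bounded_mult) auto
  note int = integrable_test_mult[OF of_bool_in_tests[OF det_quantizer_pos[OF G]] g]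
    integrable_test_mult[OF of_bool_in_tests[OF \<phi>] this]
  have "of_bool (tie_break G \<phi> x) * g x =
      of_bool (0 < G x) * g x + of_bool (\<phi> x) * (of_bool (G x = 0) * g x)" for x
    by (simp add: tie_break_def)
  with int show ?thesis by simp
qed

lemma expectation_accept_integral_tie_break:
  fixes g :: "'a \<Rightarrow> real"
  assumes "G \<in> borel_measurable N" and "integrable N g" and "q \<in> finite_pmfs (det_quantizers N)"
  shows "measure_pmf.expectation (map_pmf (tie_break G) q) (accept_integral N g) =
    accept_integral N g (\<lambda>x. 0 < G x) +
    measure_pmf.expectation q (accept_integral N (\<lambda>x. of_bool (G x = 0) * g x))"
proof -
  have "measure_pmf.expectation q (\<lambda>\<phi>. accept_integral N g (tie_break G \<phi>)) =
    measure_pmf.expectation q (\<lambda>\<phi>. accept_integral N g (\<lambda>x. 0 < G x) +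
      accept_integral N (\<lambda>x. of_bool (G x = 0) * g x) \<phi>)"
    using assms
    by (intro integral_cong_AE)
      (auto simp: AE_measure_pmf_iff finite_pmfs_def accept_integral_tie_break)
  also have "\<dots> = accept_integral N g (\<lambda>x. 0 < G x) +
    measure_pmf.expectation q (accept_integral N (\<lambda>x. of_bool (G x = 0) * g x))"
    using assms(3) by (simp add: finite_pmfs_def integrable_measure_pmf_finite)
  finally show ?thesis by simp
qed

text \<open>The value of the functional does not depend on how ties are broken, which recovers the
  coordinate that is not matched on the ties.\<close>

lemma ex_tie_break_mixture:
  fixes g :: "'j \<Rightarrow> 'a \<Rightarrow> real" and a :: "'j \<Rightarrow> real" and J :: "'j set"
  defines "G \<equiv> \<lambda>x. \<Sum>j\<in>J. a j * g j x"
  assumes i: "finite J" "i \<in> J" "a i \<noteq> 0" and g: "\<And>j. j \<in> J \<Longrightarrow> integrable N (g j)"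
    and max: "accept_integral N G (\<lambda>x. 0 < G x) = (\<Sum>j\<in>J. a j * v j)"
    and q: "q \<in> finite_pmfs (det_quantizers N)"
    and ties: "\<And>j. j \<in> J - {i} \<Longrightarrow>
      measure_pmf.expectation q (accept_integral N (\<lambda>x. of_bool (G x = 0) * g j x)) =
      v j - accept_integral N (g j) (\<lambda>x. 0 < G x)"
  shows "\<exists>q\<in>finite_pmfs (det_quantizers N).
    \<forall>j\<in>J. measure_pmf.expectation q (accept_integral N (g j)) = v j"
proof -
  have G: "integrable N G" using g by (simp add: G_def)
  then have Gm: "G \<in> borel_measurable N" by auto
  define q' where "q' = map_pmf (tie_break G) q"
  have q': "q' \<in> finite_pmfs (det_quantizers N)"
    unfolding q'_def using q
    by (rule map_pmf_in_finite_pmfs) (auto intro: det_quantizer_tie_break Gm)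
  have eq: "measure_pmf.expectation q' (accept_integral N (g j)) = v j" if "j \<in> J - {i}" for j
    using ties[OF that] expectation_accept_integral_tie_break[OF Gm g q] that by (simp add: q'_def)
  have "accept_integral N (\<lambda>x. of_bool (G x = 0) * G x) \<phi> = 0" for \<phi>
    by (rule integral_eq_zero_AE) auto
  then have "measure_pmf.expectation q' (accept_integral N G) = (\<Sum>j\<in>J. a j * v j)"
    using expectation_accept_integral_tie_break[OF Gm G q] max by (simp add: q'_def)
  then have "(\<Sum>j\<in>J. a j * measure_pmf.expectation q' (accept_integral N (g j))) = (\<Sum>j\<in>J. a j * v j)"
    unfolding G_def by (subst (asm) expectation_accept_integral_sum[OF q' g])
  then have "measure_pmf.expectation q' (accept_integral N (g i)) = v i"
    using eq by (rule sum_mult_eq_imp_coordinate_eq[where a = a, OF i])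
  with eq q' show ?thesis by blast
qed

lemma test_integral_limit_finite_pmf:
  fixes g :: "'j \<Rightarrow> 'a \<Rightarrow> real"
  assumes "finite J" and "\<And>j. j \<in> J \<Longrightarrow> integrable N (g j)" and h: "\<And>n. h n \<in> tests N"
    and "\<And>j. j \<in> J \<Longrightarrow> (\<lambda>n. \<integral>x. h n x * g j x \<partial>N) \<longlonglongrightarrow> v j"
  shows "\<exists>q\<in>finite_pmfs (det_quantizers N).
    \<forall>j\<in>J. measure_pmf.expectation q (accept_integral N (g j)) = v j"
  using assms(1,2,4)
proof (induction J arbitrary: g v rule: finite_psubset_induct)
  case (psubset J)
  have "(\<lambda>_. True) \<in> det_quantizers N" by (simp add: det_quantizer_def)
  then consider (mixture) ?case
    | (halfspace) a where "\<exists>j\<in>J. a j \<noteq> 0" "\<And>\<phi>. \<phi> \<in> det_quantizers N \<Longrightarrow>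
        (\<Sum>j\<in>J. a j * accept_integral N (g j) \<phi>) \<le> (\<Sum>j\<in>J. a j * v j)"
    using finite_pmf_or_supporting_halfspace[OF psubset.hyps, of "det_quantizers N"
        "\<lambda>j. accept_integral N (g j)" v]
    by blast
  then show ?case
  proof cases
    case halfspace
    then obtain i where i: "i \<in> J" "a i \<noteq> 0" by blast
    define G where "G = (\<lambda>x. \<Sum>j\<in>J. a j * g j x)"
    have "integrable N G" using psubset.prems(1) by (simp add: G_def)
    then have Gm: "G \<in> borel_measurable N" by auto
    then have supp: "(\<Sum>j\<in>J. a j * accept_integral N (g j) (\<lambda>x. 0 < G x)) \<le> (\<Sum>j\<in>J. a j * v j)"
      by (intro halfspace(2)) (simp add: det_quantizer_pos)
    have max: "accept_integral N G (\<lambda>x. 0 < G x) = (\<Sum>j\<in>J. a j * v j)"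
      unfolding G_def
      by (rule supported_test_limit) (use psubset.prems h supp in \<open>auto simp: G_def\<close>)
    have "(\<lambda>n. \<integral>x. h n x * (of_bool (G x = 0) * g j x) \<partial>N)
        \<longlonglongrightarrow> v j - accept_integral N (g j) (\<lambda>x. 0 < G x)" if "j \<in> J" for j
      unfolding G_def
      by (rule supported_test_limit) (use psubset.prems h supp that in \<open>auto simp: G_def\<close>)
    moreover have "integrable N (\<lambda>x. of_bool (G x = 0) * g j x)" if "j \<in> J" for j
      using psubset.prems(1)[OF that] Gm by (intro integrable_bounded_mult) auto
    ultimately obtain q where q: "q \<in> finite_pmfs (det_quantizers N)"
      "\<And>j. j \<in> J - {i} \<Longrightarrow>
        measure_pmf.expectation q (accept_integral N (\<lambda>x. of_bool (G x = 0) * g j x)) =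
        v j - accept_integral N (g j) (\<lambda>x. 0 < G x)"
      using psubset.IH[of "J - {i}" "\<lambda>j x. of_bool (G x = 0) * g j x"
          "\<lambda>j. v j - accept_integral N (g j) (\<lambda>x. 0 < G x)"] i(1) by blast
    show ?thesis
      by (rule ex_tie_break_mixture[where a = a and i = i and q = q and J = J])
        (use psubset.hyps i psubset.prems(1) max q in \<open>simp_all add: G_def\<close>)
  qed
qed

section \<open>Divergences\<close>

lemma klterm_eq: "klterm p q = p * ln (p / q)"
  by (simp add: klterm_def)

lemma klterm_mult_left: "klterm (c * p) (c * q) = c * klterm p q"
  by (cases "c = 0") (simp_all add: klterm_eq)

lemma klterm_ge_tangent:
  assumes "0 \<le> p" "0 \<le> q" "q = 0 \<Longrightarrow> p = 0" "0 < c"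
  shows "p * (ln c + 1) - c * q \<le> klterm p q"
proof (cases "p = 0")
  case True
  with assms show ?thesis by (simp add: klterm_eq)
next
  case False
  then have pq: "0 < p" "0 < q" using assms by (auto simp: order_less_le)
  then have "ln (c * q / p) \<le> c * q / p - 1"
    using assms(4) by (intro ln_le_minus_one) simp
  moreover have "ln (c * q / p) = ln c - ln (p / q)"
    using assms(4) pq by (simp add: ln_mult ln_div)
  ultimately have "p * (ln c - ln (p / q)) \<le> p * (c * q / p - 1)"
    using pq by (intro mult_left_mono) auto
  then show ?thesis using pq by (simp add: klterm_eq algebra_simps)
qed

lemma klterm_integral_le:
  fixes u v :: "'a \<Rightarrow> real"
  assumes u: "integrable M u" and v: "integrable M v"
    and uv: "integrable M (\<lambda>x. klterm (u x) (v x))"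
    and nonneg: "AE x in M. 0 \<le> u x \<and> 0 \<le> v x" and ac: "AE x in M. v x = 0 \<longrightarrow> u x = 0"
  shows "klterm (\<integral>x. u x \<partial>M) (\<integral>x. v x \<partial>M) \<le> (\<integral>x. klterm (u x) (v x) \<partial>M)"
proof -
  let ?U = "\<integral>x. u x \<partial>M" and ?V = "\<integral>x. v x \<partial>M"
  have u0: "AE x in M. 0 \<le> u x" and v0: "AE x in M. 0 \<le> v x"
    using nonneg by (auto elim: eventually_mono)
  show ?thesis
  proof (cases "?U = 0")
    case True
    then have "AE x in M. u x = 0"
      using integral_nonneg_eq_0_iff_AE[OF u u0] by simp
    then have "(\<integral>x. klterm (u x) (v x) \<partial>M) = 0"
      by (intro integral_eq_zero_AE) (auto simp: klterm_eq elim: eventually_mono)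
    with True show ?thesis by (simp add: klterm_eq)
  next
    case False
    have "?V \<noteq> 0"
    proof
      assume "?V = 0"
      then have "AE x in M. v x = 0"
        using integral_nonneg_eq_0_iff_AE[OF v v0] by simp
      with ac have "AE x in M. u x = 0" by eventually_elim simp
      with False show False by (simp add: integral_eq_zero_AE)
    qed
    define c where "c = ?U / ?V"
    have "0 < ?U" "0 < ?V"
      using False \<open>?V \<noteq> 0\<close> integral_nonneg_AE[OF u0] integral_nonneg_AE[OF v0] by auto
    then have c: "0 < c" "c * ?V = ?U" by (simp_all add: c_def)
    have "klterm ?U ?V = ?U * (ln c + 1) - c * ?V"
      using c(2) by (simp add: klterm_eq c_def algebra_simps)
    also have "\<dots> = (\<integral>x. u x * (ln c + 1) - c * v x \<partial>M)"
      using u v by simp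
    also have "\<dots> \<le> (\<integral>x. klterm (u x) (v x) \<partial>M)"
    proof (rule integral_mono_AE)
      show "AE x in M. u x * (ln c + 1) - c * v x \<le> klterm (u x) (v x)"
        using nonneg ac by eventually_elim (use c(1) in \<open>auto intro: klterm_ge_tangent\<close>)
    qed (use u v uv in auto)
    finally show ?thesis .
  qed
qed

definition binary_kl :: "real \<Rightarrow> real \<Rightarrow> real" where
  "binary_kl p q = klterm p q + klterm (1 - p) (1 - q)"

lemma binary_kl_nonneg:
  assumes "p \<in> {0..1}" "q \<in> {0..1}" "q = 0 \<Longrightarrow> p = 0" "q = 1 \<Longrightarrow> p = 1"
  shows "0 \<le> binary_kl p q"
  using assms klterm_ge_tangent[of p q 1] klterm_ge_tangent[of "1 - p" "1 - q" 1]
  by (auto simp: binary_kl_def)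

lemma binary_kl_expectation_le:
  assumes "finite (set_pmf q)"
    and "\<And>i. i \<in> set_pmf q \<Longrightarrow> u i \<in> {0..1} \<and> v i \<in> {0..1}"
    and "\<And>i. i \<in> set_pmf q \<Longrightarrow> v i = 0 \<Longrightarrow> u i = 0" "\<And>i. i \<in> set_pmf q \<Longrightarrow> v i = 1 \<Longrightarrow> u i = 1"
  shows "binary_kl (measure_pmf.expectation q u) (measure_pmf.expectation q v)
    \<le> measure_pmf.expectation q (\<lambda>i. binary_kl (u i) (v i))"
proof -
  have int: "integrable (measure_pmf q) h" for h :: "'a \<Rightarrow> real"
    using assms(1) by (rule integrable_measure_pmf_finite)
  have "klterm (measure_pmf.expectation q u) (measure_pmf.expectation q v)
      \<le> measure_pmf.expectation q (\<lambda>i. klterm (u i) (v i))"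
    using assms(2,3) by (intro klterm_integral_le int) (auto simp: AE_measure_pmf_iff)
  moreover have
    "klterm (measure_pmf.expectation q (\<lambda>i. 1 - u i)) (measure_pmf.expectation q (\<lambda>i. 1 - v i))
      \<le> measure_pmf.expectation q (\<lambda>i. klterm (1 - u i) (1 - v i))"
    using assms(2,4) by (intro klterm_integral_le int) (auto simp: AE_measure_pmf_iff)
  ultimately show ?thesis by (simp add: binary_kl_def int)
qed

lemma Irand_map_pmf:
  fixes R :: nat
  assumes "set_pmf t \<subseteq> {..<R}"
  shows "Irand N f m l (map_pmf \<phi> t) = (\<Sum>i<R. pmf t i * Idet N f m l (\<phi> i))"
  unfolding Irand_def integral_map_pmf using assms
  by (subst integral_measure_pmf[of "{..<R}"]) auto

lemma Irand_bind_pmf: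
  fixes R :: nat
  assumes "set_pmf s \<subseteq> {..<R}" and "\<And>i. i \<in> {..<R} \<Longrightarrow> q i \<in> finite_pmfs C"
  shows "Irand N f m l (bind_pmf s q) = (\<Sum>i<R. pmf s i * Irand N f m l (q i))"
proof -
  have "s \<in> finite_pmfs {..<R}"
    using assms(1) by (intro finite_pmfsI) auto
  then have "Irand N f m l (bind_pmf s q) = measure_pmf.expectation s (\<lambda>i. Irand N f m l (q i))"
    unfolding Irand_def using assms(2) by (rule expectation_bind_finite_pmf)
  also have "\<dots> = (\<Sum>i<R. pmf s i * Irand N f m l (q i))"
    using assms(1) by (subst integral_measure_pmf[of "{..<R}"]) auto
  finally show ?thesis .
qed

section \<open>Error probabilities of randomized tests\<close>

locale observation_model =
  fixes N :: "'a measure" and f :: "nat \<Rightarrow> 'a \<Rightarrow> real" and M :: nat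
  assumes f_measurable [measurable]: "\<And>k. k < M \<Longrightarrow> f k \<in> borel_measurable N"
    and f_nonneg: "\<And>k x. k < M \<Longrightarrow> x \<in> space N \<Longrightarrow> 0 \<le> f k x"
    and prob_space_Pm: "\<And>k. k < M \<Longrightarrow> prob_space (Pm N f k)"
    and AE_Pm_pos: "\<And>k l. k < M \<Longrightarrow> l < M \<Longrightarrow> k \<noteq> l \<Longrightarrow> AE x in Pm N f k. 0 < f l x"
    and llr_integrable: "\<And>k l. k < M \<Longrightarrow> l < M \<Longrightarrow> k \<noteq> l \<Longrightarrow>
      integrable (Pm N f k) (\<lambda>x. ln (f k x / f l x))"
begin

lemma AE_f_nonneg: "k < M \<Longrightarrow> AE x in N. 0 \<le> f k x"
  using f_nonneg by auto

lemma f_integrable: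
  assumes "k < M"
  shows "integrable N (f k)"
proof -
  interpret prob_space "density N (f k)" using prob_space_Pm[OF assms] by (simp add: Pm_def)
  have "integrable (density N (f k)) (\<lambda>_. 1 :: real)" by simp
  then show ?thesis using assms AE_f_nonneg by (subst (asm) integrable_density) auto
qed

lemma integral_f:
  assumes "k < M"
  shows "(\<integral>x. f k x \<partial>N) = 1"
proof -
  interpret prob_space "density N (f k)" using prob_space_Pm[OF assms] by (simp add: Pm_def)
  have "(\<integral>x. 1 \<partial>density N (f k)) = (1 :: real)" using prob_space by simp
  then show ?thesis using assms AE_f_nonneg by (subst (asm) integral_density) auto
qed

lemma AE_f_zero:
  assumes "k < M" "l < M"
  shows "AE x in N. f l x = 0 \<longrightarrow> f k x = 0"
proof (cases "k = l")
  case False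
  from AE_Pm_pos[OF assms False] assms(1) have "AE x in N. 0 < ennreal (f k x) \<longrightarrow> 0 < f l x"
    unfolding Pm_def by (subst (asm) AE_density) auto
  with AE_f_nonneg[OF assms(1)] show ?thesis by eventually_elim (auto simp: order_less_le)
qed simp

lemma klterm_f_integrable:
  assumes "k < M" "l < M" "k \<noteq> l"
  shows "integrable N (\<lambda>x. klterm (f k x) (f l x))"
  using llr_integrable[OF assms] assms AE_f_nonneg unfolding Pm_def klterm_eq
  by (subst (asm) integrable_density) auto

definition test_power :: "('a \<Rightarrow> real) \<Rightarrow> nat \<Rightarrow> real" where
  "test_power h k = (\<integral>x. h x * f k x \<partial>N)"

lemma test_power_compl: "h \<in> tests N \<Longrightarrow> k < M \<Longrightarrow> test_power (\<lambda>x. 1 - h x) k = 1 - test_power h k"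
  using integral_f[of k] f_integrable[of k] integrable_test_mult[of h N "f k"]
  by (simp add: test_power_def left_diff_distrib)

lemma test_power_nonneg: "h \<in> tests N \<Longrightarrow> k < M \<Longrightarrow> 0 \<le> test_power h k"
  unfolding test_power_def by (intro integral_nonneg_AE) (auto simp: test_nonneg f_nonneg)

lemma test_power_le_1: "h \<in> tests N \<Longrightarrow> k < M \<Longrightarrow> test_power h k \<le> 1"
  using test_power_nonneg[OF test_compl, of h k] test_power_compl[of h k] by simp

lemma test_integral_tendsto_0:
  fixes g :: "'a \<Rightarrow> real"
  assumes h: "\<And>n. h n \<in> tests N" and k: "k < M" and lim: "(\<lambda>n. test_power (h n) k) \<longlonglongrightarrow> 0"
    and g: "integrable N g" "AE x in N. f k x = 0 \<longrightarrow> g x = 0"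
  shows "(\<lambda>n. \<integral>x. h n x * g x \<partial>N) \<longlonglongrightarrow> 0"
proof (rule tendsto_integral_bounded_mult_0[OF _ _ f_integrable[OF k] g])
  have "(\<integral>x. \<bar>h n x * f k x\<bar> \<partial>N) = test_power (h n) k" for n
    unfolding test_power_def using h k
    by (intro Bochner_Integration.integral_cong)
      (auto simp: abs_mult test_nonneg[OF h] f_nonneg)
  with lim show "(\<lambda>n. \<integral>x. \<bar>h n x * f k x\<bar> \<partial>N) \<longlonglongrightarrow> 0" by simp
qed (auto simp: test_measurable[OF h] test_nonneg[OF h] test_le_1[OF h])

lemma test_power_tendsto_0:
  assumes h: "\<And>n. h n \<in> tests N" and kl: "k < M" "l < M" and lim: "(\<lambda>n. test_power (h n) k) \<longlonglongrightarrow> 0"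
  shows "(\<lambda>n. test_power (h n) l) \<longlonglongrightarrow> 0"
  unfolding test_power_def using h kl(1) lim f_integrable[OF kl(2)] AE_f_zero[OF kl(2,1)]
  by (rule test_integral_tendsto_0)

lemma test_power_eq_0:
  assumes "h \<in> tests N" "k < M" "l < M" "test_power h k = 0"
  shows "test_power h l = 0"
  using test_power_tendsto_0[of "\<lambda>_. h" k l] assms by (simp add: LIMSEQ_const_iff)

lemma test_power_eq_1:
  assumes "h \<in> tests N" "k < M" "l < M" "test_power h k = 1"
  shows "test_power h l = 1"
  using test_power_eq_0[OF test_compl, of h k l] assms by (simp add: test_power_compl)

lemma klterm_test_power_le:
  assumes h: "h \<in> tests N" and kl: "k < M" "l < M" "k \<noteq> l"
  shows "klterm (test_power h k) (test_power h l) \<le> (\<integral>x. h x * klterm (f k x) (f l x) \<partial>N)"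
  unfolding test_power_def klterm_mult_left[symmetric]
proof (rule klterm_integral_le)
  show "integrable N (\<lambda>x. klterm (h x * f k x) (h x * f l x))"
    unfolding klterm_mult_left by (rule integrable_test_mult[OF h klterm_f_integrable[OF kl]])
  show "AE x in N. 0 \<le> h x * f k x \<and> 0 \<le> h x * f l x"
    using h kl by (auto simp: test_nonneg f_nonneg)
  show "AE x in N. h x * f l x = 0 \<longrightarrow> h x * f k x = 0"
    using AE_f_zero[OF kl(1,2)] by eventually_elim auto
qed (use h kl f_integrable in \<open>auto intro: integrable_test_mult\<close>)

lemma klterm_test_power_ge:
  assumes h: "h \<in> tests N" and kl: "k < M" "l < M"
  shows "test_power h k - test_power h l \<le> klterm (test_power h k) (test_power h l)"
  using klterm_ge_tangent[of "test_power h k" "test_power h l" 1]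
    test_power_nonneg[OF h] test_power_eq_0[OF h kl(2,1)] kl
  by simp

lemma klterm_test_power_tendsto:
  assumes h: "\<And>n. h n \<in> tests N" and kl: "k < M" "l < M" "k \<noteq> l"
    and p: "(\<lambda>n. test_power (h n) k) \<longlonglongrightarrow> p" and q: "(\<lambda>n. test_power (h n) l) \<longlonglongrightarrow> q"
  shows "(\<lambda>n. klterm (test_power (h n) k) (test_power (h n) l)) \<longlonglongrightarrow> klterm p q"
proof (cases "p = 0")
  case True
  then have "q = 0"
    using p by (intro LIMSEQ_unique[OF q] test_power_tendsto_0[OF h kl(1,2)]) simp
  with True have lower: "(\<lambda>n. test_power (h n) k - test_power (h n) l) \<longlonglongrightarrow> 0"
    using tendsto_diff[OF p q] by simp
  have "AE x in N. f k x = 0 \<longrightarrow> klterm (f k x) (f l x) = 0" by (simp add: klterm_eq)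
  with h kl(1) p[unfolded True] klterm_f_integrable[OF kl]
  have upper: "(\<lambda>n. \<integral>x. h n x * klterm (f k x) (f l x) \<partial>N) \<longlonglongrightarrow> 0"
    by (rule test_integral_tendsto_0)
  have "(\<lambda>n. klterm (test_power (h n) k) (test_power (h n) l)) \<longlonglongrightarrow> 0"
    using klterm_test_power_ge[OF h kl(1,2)] klterm_test_power_le[OF h kl]
    by (intro tendsto_sandwich[OF _ _ lower upper]) simp_all
  with True show ?thesis by (simp add: klterm_eq)
next
  case False
  have "q \<noteq> 0"
  proof
    assume "q = 0"
    then have "p = 0" using q by (intro LIMSEQ_unique[OF p] test_power_tendsto_0[OF h kl(2,1)]) simp
    with False show False by simp
  qed
  with False p q show ?thesis unfolding klterm_eq by (intro tendsto_intros) auto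
qed

lemma binary_kl_test_power_tendsto:
  assumes h: "\<And>n. h n \<in> tests N" and kl: "k < M" "l < M" "k \<noteq> l"
    and p: "(\<lambda>n. test_power (h n) k) \<longlonglongrightarrow> p" and q: "(\<lambda>n. test_power (h n) l) \<longlonglongrightarrow> q"
  shows "(\<lambda>n. binary_kl (test_power (h n) k) (test_power (h n) l)) \<longlonglongrightarrow> binary_kl p q"
proof -
  have "(\<lambda>n. klterm (test_power (\<lambda>x. 1 - h n x) k) (test_power (\<lambda>x. 1 - h n x) l))
      \<longlonglongrightarrow> klterm (1 - p) (1 - q)"
    using h kl p q
    by (intro klterm_test_power_tendsto test_compl)
      (auto simp: test_power_compl intro: tendsto_intros)
  with klterm_test_power_tendsto[OF h kl p q] show ?thesis
    using h kl by (simp add: binary_kl_def test_power_compl tendsto_add)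
qed

lemma binary_kl_test_power_le:
  assumes h: "h \<in> tests N" and kl: "k < M" "l < M" "k \<noteq> l"
  shows "binary_kl (test_power h k) (test_power h l) \<le> (\<integral>x. klterm (f k x) (f l x) \<partial>N)"
proof -
  let ?g = "\<lambda>x. klterm (f k x) (f l x)"
  have "binary_kl (test_power h k) (test_power h l) \<le>
      (\<integral>x. h x * ?g x \<partial>N) + (\<integral>x. (1 - h x) * ?g x \<partial>N)"
    unfolding binary_kl_def
    using klterm_test_power_le[OF h kl] klterm_test_power_le[OF test_compl[OF h] kl] h kl
    by (simp add: test_power_compl)
  also have "\<dots> = (\<integral>x. h x * ?g x + (1 - h x) * ?g x \<partial>N)"
    using klterm_f_integrable[OF kl] h by (simp add: integrable_test_mult test_compl)
  also have "\<dots> = (\<integral>x. ?g x \<partial>N)" by (simp add: algebra_simps)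
  finally show ?thesis .
qed

lemma binary_kl_test_power_nonneg:
  assumes h: "h \<in> tests N" and kl: "k < M" "l < M"
  shows "0 \<le> binary_kl (test_power h k) (test_power h l)"
  using test_power_nonneg[OF h] test_power_le_1[OF h] kl
    test_power_eq_0[OF h kl(2,1)] test_power_eq_1[OF h kl(2,1)]
  by (intro binary_kl_nonneg) auto

section \<open>Deterministic quantizers\<close>

abbreviation accept_prob :: "('a \<Rightarrow> bool) \<Rightarrow> nat \<Rightarrow> real" where
  "accept_prob \<phi> k \<equiv> test_power (\<lambda>x. of_bool (\<phi> x)) k"

lemma qprob_True:
  assumes "det_quantizer N \<phi>" "k < M"
  shows "qprob N f k \<phi> True = accept_prob \<phi> k"
proof -
  have [measurable]: "\<phi> \<in> N \<rightarrow>\<^sub>M count_space UNIV"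
    using assms(1) by (simp add: det_quantizer_def)
  have "qprob N f k \<phi> True = (\<integral>x. indicator {x \<in> space N. \<phi> x} x \<partial>Pm N f k)"
    by (simp add: qprob_def Pm_def Int_absorb2)
  also have "\<dots> = (\<integral>x. f k x *\<^sub>R indicator {x \<in> space N. \<phi> x} x \<partial>N)"
    unfolding Pm_def using assms(2) AE_f_nonneg by (intro integral_density) auto
  also have "\<dots> = accept_prob \<phi> k"
    by (auto simp: test_power_def indicator_def intro!: Bochner_Integration.integral_cong)
  finally show ?thesis .
qed

lemma qprob_False:
  assumes "det_quantizer N \<phi>" "k < M"
  shows "qprob N f k \<phi> False = 1 - accept_prob \<phi> k"
proof -
  have [measurable]: "\<phi> \<in> N \<rightarrow>\<^sub>M count_space UNIV"
    using assms(1) by (simp add: det_quantizer_def)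
  have "det_quantizer N (\<lambda>x. \<not> \<phi> x)" unfolding det_quantizer_def by measurable
  from qprob_True[OF this assms(2)] have "qprob N f k \<phi> False = accept_prob (\<lambda>x. \<not> \<phi> x) k"
    by (simp add: qprob_def)
  also have "\<dots> = 1 - accept_prob \<phi> k"
    using test_power_compl[OF of_bool_in_tests[OF assms(1)] assms(2)] by (simp add: of_bool_not_iff)
  finally show ?thesis .
qed

lemma Idet_eq_binary_kl:
  assumes "det_quantizer N \<phi>" "k < M" "l < M"
  shows "Idet N f k l \<phi> = binary_kl (accept_prob \<phi> k) (accept_prob \<phi> l)"
  using assms by (simp add: Idet_def UNIV_bool binary_kl_def qprob_True qprob_False)

lemma Idet_nonneg: "det_quantizer N \<phi> \<Longrightarrow> k < M \<Longrightarrow> l < M \<Longrightarrow> 0 \<le> Idet N f k l \<phi>"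
  by (simp add: Idet_eq_binary_kl binary_kl_test_power_nonneg of_bool_in_tests)

lemma Idet_le:
  "det_quantizer N \<phi> \<Longrightarrow> k < M \<Longrightarrow> l < M \<Longrightarrow> k \<noteq> l \<Longrightarrow>
    Idet N f k l \<phi> \<le> (\<integral>x. klterm (f k x) (f l x) \<partial>N)"
  by (simp add: Idet_eq_binary_kl binary_kl_test_power_le of_bool_in_tests)

definition generates_test_limits :: "('a \<Rightarrow> bool) set \<Rightarrow> bool" where
  "generates_test_limits C \<longleftrightarrow> (\<forall>\<phi>\<in>C. det_quantizer N \<phi>) \<and>
    (\<forall>h v. (\<forall>n :: nat. h n \<in> tests N) \<longrightarrow> (\<forall>k<M. (\<lambda>n. test_power (h n) k) \<longlonglongrightarrow> v k) \<longrightarrow>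
      (\<exists>q\<in>finite_pmfs C. \<forall>k<M. measure_pmf.expectation q (\<lambda>\<phi>. accept_prob \<phi> k) = v k))"

lemma generates_test_limits_det: "generates_test_limits C \<Longrightarrow> \<phi> \<in> C \<Longrightarrow> det_quantizer N \<phi>"
  by (simp add: generates_test_limits_def)

lemma generates_test_limitsD:
  fixes h :: "nat \<Rightarrow> 'a \<Rightarrow> real"
  assumes "generates_test_limits C" "\<And>n. h n \<in> tests N"
    and "\<And>k. k < M \<Longrightarrow> (\<lambda>n. test_power (h n) k) \<longlonglongrightarrow> v k"
  shows "\<exists>q\<in>finite_pmfs C. \<forall>k<M. measure_pmf.expectation q (\<lambda>\<phi>. accept_prob \<phi> k) = v k"
  using assms(2,3) by (rule assms(1)[unfolded generates_test_limits_def, THEN conjunct2, rule_format])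

lemma det_quantizers_generate_test_limits: "generates_test_limits (det_quantizers N)"
  unfolding generates_test_limits_def
proof (intro conjI allI impI)
  fix h v assume "\<forall>n :: nat. h n \<in> tests N" and "\<forall>k<M. (\<lambda>n. test_power (h n) k) \<longlonglongrightarrow> v k"
  then show "\<exists>q\<in>finite_pmfs (det_quantizers N).
      \<forall>k<M. measure_pmf.expectation q (\<lambda>\<phi>. accept_prob \<phi> k) = v k"
    using test_integral_limit_finite_pmf[of "{..<M}" N f h v] f_integrable
    by (auto simp: test_power_def)
qed simp

definition likelihood_quantizer :: "(nat \<Rightarrow> real) \<Rightarrow> 'a \<Rightarrow> bool" where
  "likelihood_quantizer a x \<longleftrightarrow> 0 < (\<Sum>k<M. a k * f k x)"

lemma det_likelihood_quantizer: "det_quantizer N (likelihood_quantizer a)"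
  unfolding likelihood_quantizer_def by (intro det_quantizer_pos borel_measurable_sum) auto

lemma ULQ_likelihood_quantizer:
  assumes "lin_indep_dens N f M" and "\<exists>k<M. a k \<noteq> 0"
  shows "ULQ N f M (likelihood_quantizer a)"
  unfolding ULQ_def using assms
  by (intro conjI det_likelihood_quantizer exI[of _ a])
    (auto simp: likelihood_quantizer_def lin_indep_dens_def)

lemma AE_zero_if_combination_zero:
  assumes "lin_indep_dens N f M" and "\<exists>k<M. a k \<noteq> 0" and "j < M"
  shows "AE x in N. (\<Sum>k<M. a k * f k x) = 0 \<longrightarrow> f j x = 0"
proof -
  have [measurable]: "(\<lambda>x. \<Sum>k<M. a k * f k x) \<in> borel_measurable N"
    by (intro borel_measurable_sum) auto
  have "emeasure (density N (f j)) {x \<in> space N. (\<Sum>k<M. a k * f k x) = 0} = 0"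
    using assms unfolding lin_indep_dens_def Pm_def by blast
  then have "AE x in density N (f j). (\<Sum>k<M. a k * f k x) \<noteq> 0"
    by (subst AE_iff_measurable[OF _ refl]) auto
  then have "AE x in N. 0 < ennreal (f j x) \<longrightarrow> (\<Sum>k<M. a k * f k x) \<noteq> 0"
    using assms(3) by (subst (asm) AE_density) auto
  with AE_f_nonneg[OF assms(3)] show ?thesis by eventually_elim (auto simp: order_less_le)
qed

lemma ULQs_generate_test_limits:
  assumes indep: "lin_indep_dens N f M" and "0 < M"
  shows "generates_test_limits {\<phi>. ULQ N f M \<phi>}"
  unfolding generates_test_limits_def
proof (intro conjI allI impI)
  let ?U = "{\<phi>. ULQ N f M \<phi>}"
  fix h v assume h: "\<forall>n :: nat. h n \<in> tests N" and v: "\<forall>k<M. (\<lambda>n. test_power (h n) k) \<longlonglongrightarrow> v k"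
  have "likelihood_quantizer (\<lambda>_. 1) \<in> ?U"
    using \<open>0 < M\<close> ULQ_likelihood_quantizer[OF indep, of "\<lambda>_. 1"] by auto
  then consider (mixture) "\<exists>q\<in>finite_pmfs ?U.
        \<forall>k\<in>{..<M}. measure_pmf.expectation q (\<lambda>\<phi>. accept_prob \<phi> k) = v k"
    | (halfspace) a where "\<exists>k\<in>{..<M}. a k \<noteq> 0"
      "\<And>\<phi>. \<phi> \<in> ?U \<Longrightarrow> (\<Sum>k<M. a k * accept_prob \<phi> k) \<le> (\<Sum>k<M. a k * v k)"
    using finite_pmf_or_supporting_halfspace[of "{..<M}" ?U "\<lambda>k \<phi>. accept_prob \<phi> k" v] by blast
  then show "\<exists>q\<in>finite_pmfs ?U. \<forall>k<M. measure_pmf.expectation q (\<lambda>\<phi>. accept_prob \<phi> k) = v k"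
  proof cases
    case halfspace
    let ?G = "\<lambda>x. \<Sum>k<M. a k * f k x"
    have a: "\<exists>k<M. a k \<noteq> 0" using halfspace(1) by blast
    have ULQ: "likelihood_quantizer a \<in> ?U"
      using ULQ_likelihood_quantizer[OF indep a] by simp
    have "accept_prob (likelihood_quantizer a) k = v k" if k: "k < M" for k
    proof -
      have "(\<lambda>n. \<integral>x. h n x * (of_bool (?G x = 0) * f k x) \<partial>N)
          \<longlonglongrightarrow> v k - accept_integral N (f k) (\<lambda>x. 0 < ?G x)"
        using halfspace(2)[OF ULQ] h v k
        by (intro supported_test_limit)
          (auto simp: test_power_def likelihood_quantizer_def f_integrable)
      moreover have "(\<integral>x. h n x * (of_bool (?G x = 0) * f k x) \<partial>N) = 0" for n
        using AE_zero_if_combination_zero[OF indep a k]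
        by (intro integral_eq_zero_AE) (auto elim: eventually_mono)
      ultimately show ?thesis
        by (simp add: LIMSEQ_const_iff test_power_def likelihood_quantizer_def)
    qed
    with ULQ show ?thesis
      by (intro bexI[of _ "return_pmf (likelihood_quantizer a)"] return_pmf_in_finite_pmfs) auto
  qed (auto simp: Ball_def)
qed (simp add: ULQ_def)

section \<open>Limits of randomized quantizers\<close>

lemma binary_kl_expectation_le_Irand:
  assumes q: "q \<in> finite_pmfs (det_quantizers N)" and kl: "k < M" "l < M"
  shows "binary_kl (measure_pmf.expectation q (\<lambda>\<phi>. accept_prob \<phi> k))
    (measure_pmf.expectation q (\<lambda>\<phi>. accept_prob \<phi> l)) \<le> Irand N f k l q" (is "?D \<le> _")
proof -
  have "?D \<le> measure_pmf.expectation q (\<lambda>\<phi>. binary_kl (accept_prob \<phi> k) (accept_prob \<phi> l))"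
  proof (rule binary_kl_expectation_le)
    fix \<phi> assume "\<phi> \<in> set_pmf q"
    then have test: "(\<lambda>x. of_bool (\<phi> x)) \<in> tests N"
      using q by (auto simp: finite_pmfs_def intro: of_bool_in_tests)
    show "accept_prob \<phi> k \<in> {0..1} \<and> accept_prob \<phi> l \<in> {0..1}"
      using test_power_nonneg[OF test] test_power_le_1[OF test] kl by simp
    show "accept_prob \<phi> l = 0 \<Longrightarrow> accept_prob \<phi> k = 0" "accept_prob \<phi> l = 1 \<Longrightarrow> accept_prob \<phi> k = 1"
      using test_power_eq_0[OF test kl(2,1)] test_power_eq_1[OF test kl(2,1)] by blast+
  qed (use q in \<open>simp add: finite_pmfs_def\<close>)
  also have "\<dots> = Irand N f k l q"
    unfolding Irand_def using q kl
    by (intro integral_cong_AE) (auto simp: AE_measure_pmf_iff finite_pmfs_def Idet_eq_binary_kl)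
  finally show ?thesis .
qed

lemma Idet_limit_le_Irand:
  assumes C: "generates_test_limits C" and m: "m < M" and \<phi>: "\<And>n. det_quantizer N (\<phi> n)"
    and lim: "\<And>k. k < M \<Longrightarrow> (\<lambda>n. accept_prob (\<phi> n) k) \<longlonglongrightarrow> v k"
  shows "\<exists>q\<in>finite_pmfs C. \<forall>l\<in>{..<M} - {m}.
    \<exists>L\<le>Irand N f m l q. (\<lambda>n. Idet N f m l (\<phi> n)) \<longlonglongrightarrow> L"
proof -
  note tests = of_bool_in_tests[OF \<phi>]
  obtain q where q: "q \<in> finite_pmfs C"
    "\<And>k. k < M \<Longrightarrow> measure_pmf.expectation q (\<lambda>\<phi>. accept_prob \<phi> k) = v k"
    using generates_test_limitsD[OF C tests lim] by blast
  then have q_det: "q \<in> finite_pmfs (det_quantizers N)"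
    using generates_test_limits_det[OF C] by (auto simp: finite_pmfs_def)
  have "\<exists>L\<le>Irand N f m l q. (\<lambda>n. Idet N f m l (\<phi> n)) \<longlonglongrightarrow> L" if "l \<in> {..<M} - {m}" for l
  proof (intro exI conjI)
    from that have l: "l < M" "m \<noteq> l" by auto
    show "(\<lambda>n. Idet N f m l (\<phi> n)) \<longlonglongrightarrow> binary_kl (v m) (v l)"
      unfolding Idet_eq_binary_kl[OF \<phi> m l(1)]
      by (rule binary_kl_test_power_tendsto[OF tests m l lim[OF m] lim[OF l(1)]])
    show "binary_kl (v m) (v l) \<le> Irand N f m l q"
      using binary_kl_expectation_le_Irand[OF q_det m l(1)] by (simp add: q(2) m l(1))
  qed
  with q(1) show ?thesis by blast
qed

lemma convergent_subseq_few_atoms: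
  fixes Q :: "nat \<Rightarrow> ('a \<Rightarrow> bool) pmf"
  assumes Q: "\<And>n. Q n \<in> finite_pmfs (det_quantizers N)" "\<And>n. card (set_pmf (Q n)) \<le> R"
  obtains r t \<phi> s v where "strict_mono r" "\<And>n. Q (r n) = map_pmf (\<phi> n) (t n)"
    "\<And>n. set_pmf (t n) \<subseteq> {..<R}" "\<And>n i. det_quantizer N (\<phi> n i)" "set_pmf s \<subseteq> {..<R}"
    "\<And>i. i < R \<Longrightarrow> (\<lambda>n. pmf (t n) i) \<longlonglongrightarrow> pmf s i"
    "\<And>i k. i < R \<Longrightarrow> k < M \<Longrightarrow> (\<lambda>n. accept_prob (\<phi> n i) k) \<longlonglongrightarrow> v i k"
proof -
  have "\<exists>t \<phi>. set_pmf t \<subseteq> {..<R} \<and> range \<phi> \<subseteq> set_pmf (Q n) \<and> Q n = map_pmf \<phi> t" for n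
    using Q by (intro finite_pmf_enumeration) (auto simp: finite_pmfs_def)
  then obtain t \<phi> where t: "\<And>n. set_pmf (t n) \<subseteq> {..<R}"
    and range: "\<And>n. range (\<phi> n) \<subseteq> set_pmf (Q n)" and Q_eq: "\<And>n. Q n = map_pmf (\<phi> n) (t n)"
    by metis
  have det: "det_quantizer N (\<phi> n i)" for n i
    using range[of n] Q(1)[of n] by (auto simp: finite_pmfs_def)
  obtain r s where r: "strict_mono r" and s: "set_pmf s \<subseteq> {..<R}"
    "\<forall>i\<in>{..<R}. (\<lambda>n. pmf (t (r n)) i) \<longlonglongrightarrow> pmf s i"
    using ex_convergent_subseq_pmf[of "{..<R}" t, OF finite_lessThan t] by blast
  let ?x = "\<lambda>n p. accept_prob (\<phi> (r n) (fst p)) (snd p)"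
  have "bounded (range (\<lambda>n. ?x n p))" if p: "p \<in> {..<R} \<times> {..<M}" for p
  proof (rule bounded_subset[OF bounded_closed_interval], rule image_subsetI)
    fix n
    have "(\<lambda>x. of_bool (\<phi> (r n) (fst p) x)) \<in> tests N" by (rule of_bool_in_tests[OF det])
    with p show "?x n p \<in> {0..1}"
      by (simp add: mem_Times_iff test_power_nonneg test_power_le_1)
  qed
  then obtain r' v where r': "strict_mono r'"
    and v: "\<forall>p\<in>{..<R} \<times> {..<M}. (\<lambda>n. ?x (r' n) p) \<longlonglongrightarrow> v p"
    using ex_convergent_subseq_finite_family[of "{..<R} \<times> {..<M}" ?x] by auto
  show thesis
  proof (rule that)
    show "strict_mono (\<lambda>n. r (r' n))"
      using strict_mono_o[OF r r'] by (simp add: o_def)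
    show "(\<lambda>n. pmf (t (r (r' n))) i) \<longlonglongrightarrow> pmf s i" if "i < R" for i
      using LIMSEQ_subseq_LIMSEQ[OF bspec[OF s(2)] r'] that by (simp add: o_def)
    show "(\<lambda>n. accept_prob (\<phi> (r (r' n)) i) k) \<longlonglongrightarrow> v (i, k)" if "i < R" "k < M" for i k
      using bspec[OF v, of "(i, k)"] that by simp
  qed (fact Q_eq t det s(1))+
qed

lemma Irand_subseq_limit_le:
  fixes Q :: "nat \<Rightarrow> ('a \<Rightarrow> bool) pmf"
  assumes C: "generates_test_limits C" and m: "m < M"
    and Q: "\<And>n. Q n \<in> finite_pmfs (det_quantizers N)" "\<And>n. card (set_pmf (Q n)) \<le> R"
  shows "\<exists>r. strict_mono r \<and> (\<exists>Q'\<in>finite_pmfs C. \<forall>l\<in>{..<M} - {m}.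
    \<exists>L\<le>Irand N f m l Q'. (\<lambda>n. Irand N f m l (Q (r n))) \<longlonglongrightarrow> L)"
proof -
  obtain r t \<phi> s v where r: "strict_mono r"
    and Q_eq: "\<And>n. Q (r n) = map_pmf (\<phi> n) (t n)" and t: "\<And>n. set_pmf (t n) \<subseteq> {..<R}"
    and det: "\<And>n i. det_quantizer N (\<phi> n i)" and s: "set_pmf s \<subseteq> {..<R}"
    and weights: "\<And>i. i < R \<Longrightarrow> (\<lambda>n. pmf (t n) i) \<longlonglongrightarrow> pmf s i"
    and atoms: "\<And>i k. i < R \<Longrightarrow> k < M \<Longrightarrow> (\<lambda>n. accept_prob (\<phi> n i) k) \<longlonglongrightarrow> v i k"
    by (rule convergent_subseq_few_atoms[of Q R, OF Q]) blast
  define limit_of where "limit_of i q \<longleftrightarrow> q \<in> finite_pmfs C \<and>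
    (\<forall>l\<in>{..<M} - {m}. \<exists>L\<le>Irand N f m l q. (\<lambda>n. Idet N f m l (\<phi> n i)) \<longlonglongrightarrow> L)" for i q
  have "\<exists>q. limit_of i q" if "i < R" for i
    using Idet_limit_le_Irand[OF C m det atoms[OF that]] by (auto simp: limit_of_def)
  then obtain q where q: "\<And>i. i < R \<Longrightarrow> limit_of i (q i)" by metis
  then have qC: "\<And>i. i \<in> {..<R} \<Longrightarrow> q i \<in> finite_pmfs C"
    by (simp add: limit_of_def)
  have "\<exists>L\<le>Irand N f m l (bind_pmf s q). (\<lambda>n. Irand N f m l (Q (r n))) \<longlonglongrightarrow> L"
    if l: "l \<in> {..<M} - {m}" for l
  proof -
    have "\<exists>L\<le>Irand N f m l (q i). (\<lambda>n. Idet N f m l (\<phi> n i)) \<longlonglongrightarrow> L" if "i < R" for i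
      using q[OF that] l by (simp add: limit_of_def)
    then obtain L where L: "\<And>i. i < R \<Longrightarrow> L i \<le> Irand N f m l (q i)"
      "\<And>i. i < R \<Longrightarrow> (\<lambda>n. Idet N f m l (\<phi> n i)) \<longlonglongrightarrow> L i"
      by metis
    have "(\<lambda>n. Irand N f m l (Q (r n))) \<longlonglongrightarrow> (\<Sum>i<R. pmf s i * L i)"
      unfolding Q_eq Irand_map_pmf[OF t] using weights L(2) by (intro tendsto_intros) auto
    moreover have "(\<Sum>i<R. pmf s i * L i) \<le> Irand N f m l (bind_pmf s q)"
    proof (subst Irand_bind_pmf[OF s qC])
      show "(\<Sum>i<R. pmf s i * L i) \<le> (\<Sum>i<R. pmf s i * Irand N f m l (q i))"
        using L(1) by (intro sum_mono mult_left_mono) auto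
    qed
    ultimately show ?thesis by blast
  qed
  moreover have "bind_pmf s q \<in> finite_pmfs C"
    using finite_pmfsI[OF finite_lessThan s] qC by (rule bind_pmf_in_finite_pmfs)
  ultimately show ?thesis using r by blast
qed

section \<open>Maximin quantizers\<close>

lemma Irand_integrable:
  assumes "rand_quantizer N Q" "k < M" "l < M" "k \<noteq> l"
  shows "integrable (measure_pmf Q) (Idet N f k l)"
  using assms Idet_nonneg[of _ k l] Idet_le[of _ k l]
  by (intro measure_pmf.integrable_const_bound[where B = "\<integral>x. klterm (f k x) (f l x) \<partial>N"])
    (auto simp: AE_measure_pmf_iff rand_quantizer_def)

lemma Irand_le:
  assumes "rand_quantizer N Q" "k < M" "l < M" "k \<noteq> l"
  shows "Irand N f k l Q \<le> (\<integral>x. klterm (f k x) (f l x) \<partial>N)"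
  unfolding Irand_def using assms Idet_le[of _ k l]
  by (intro measure_pmf.integral_le_const Irand_integrable)
    (auto simp: AE_measure_pmf_iff rand_quantizer_def)

lemma rand_quantizer_if_finite_pmf:
  assumes "generates_test_limits C" and "q \<in> finite_pmfs C"
  shows "rand_quantizer N q"
  using assms generates_test_limits_det by (auto simp: rand_quantizer_def finite_pmfs_def)

context
  fixes m :: nat
  assumes m: "m < M" and M: "2 \<le> M"
begin

lemma card_alternatives: "card ({..<M} - {m}) = M - 1"
  using m by simp

lemma alternatives_nonempty: "{..<M} - {m} \<noteq> {}"
proof -
  have "0 < card ({..<M} - {m})" unfolding card_alternatives using M by simp
  then show ?thesis unfolding card_gt_0_iff by blast
qed

lemma ex_few_atoms_Irand_ge:
  assumes "rand_quantizer N Q"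
  shows "\<exists>Q'\<in>finite_pmfs (set_pmf Q). card (set_pmf Q') \<le> M - 1 \<and>
    (\<forall>l\<in>{..<M} - {m}. Irand N f m l Q \<le> Irand N f m l Q')"
  unfolding card_alternatives[symmetric] Irand_def
  using alternatives_nonempty Irand_integrable[OF assms m]
  by (intro ex_pmf_few_atoms_dominating) auto

lemma Imin_eq_Min_image: "Imin N f M m Q = Min ((\<lambda>l. Irand N f m l Q) ` ({..<M} - {m}))"
  unfolding Imin_def by (rule arg_cong[where f = Min]) auto

lemma Imin_le: "l \<in> {..<M} - {m} \<Longrightarrow> Imin N f M m Q \<le> Irand N f m l Q"
  unfolding Imin_eq_Min_image by (intro Min_le) auto

lemma Imin_ge:
  assumes "\<And>l. l \<in> {..<M} - {m} \<Longrightarrow> c \<le> Irand N f m l Q"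
  shows "c \<le> Imin N f M m Q"
  unfolding Imin_eq_Min_image using assms alternatives_nonempty by (subst Min_ge_iff) auto

lemma bdd_above_Imin: "bdd_above (Imin N f M m ` {Q. rand_quantizer N Q})"
proof -
  obtain l where l: "l \<in> {..<M} - {m}" using alternatives_nonempty by blast
  show ?thesis
  proof (rule bdd_aboveI2)
    fix Q assume "Q \<in> {Q. rand_quantizer N Q}"
    with l have "Irand N f m l Q \<le> (\<integral>x. klterm (f m x) (f l x) \<partial>N)"
      by (intro Irand_le m) auto
    with Imin_le[OF l] show "Imin N f M m Q \<le> (\<integral>x. klterm (f m x) (f l x) \<partial>N)"
      by (rule order_trans)
  qed
qed

lemma maximinI:
  assumes "rand_quantizer N Q" and "\<And>l. l \<in> {..<M} - {m} \<Longrightarrow> Isup N f M m \<le> Irand N f m l Q"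
  shows "maximin N f M m Q"
proof -
  have "Imin N f M m Q \<le> Isup N f M m"
    unfolding Isup_def using assms(1) by (intro cSUP_upper bdd_above_Imin) simp
  moreover have "Isup N f M m \<le> Imin N f M m Q"
    using assms(2) by (rule Imin_ge)
  ultimately show ?thesis using assms(1) by (simp add: maximin_def)
qed

lemma ex_few_atoms_near_Isup:
  assumes "0 < e"
  shows "\<exists>Q\<in>finite_pmfs (det_quantizers N). card (set_pmf Q) \<le> M - 1 \<and>
    (\<forall>l\<in>{..<M} - {m}. Isup N f M m - e \<le> Irand N f m l Q)"
proof -
  have "rand_quantizer N (return_pmf (\<lambda>_. True))"
    by (simp add: rand_quantizer_def det_quantizer_def)
  then obtain P where P: "rand_quantizer N P" "Isup N f M m - e < Imin N f M m P"
    using assms less_cSUP_iff[OF _ bdd_above_Imin, of "Isup N f M m - e"] by (auto simp: Isup_def)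
  obtain Q where Q: "Q \<in> finite_pmfs (set_pmf P)" "card (set_pmf Q) \<le> M - 1"
    "\<And>l. l \<in> {..<M} - {m} \<Longrightarrow> Irand N f m l P \<le> Irand N f m l Q"
    using ex_few_atoms_Irand_ge[OF P(1)] by blast
  have "Isup N f M m - e \<le> Irand N f m l Q" if "l \<in> {..<M} - {m}" for l
    using P(2) Imin_le[OF that, of P] Q(3)[OF that] by linarith
  moreover have "Q \<in> finite_pmfs (det_quantizers N)"
    using P(1) Q(1) by (auto simp: rand_quantizer_def finite_pmfs_def)
  ultimately show ?thesis using Q(2) by blast
qed

lemma ex_finite_pmf_Irand_ge_Isup:
  assumes C: "generates_test_limits C"
  shows "\<exists>P\<in>finite_pmfs C. \<forall>l\<in>{..<M} - {m}. Isup N f M m \<le> Irand N f m l P"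
proof -
  have "\<exists>Q\<in>finite_pmfs (det_quantizers N). card (set_pmf Q) \<le> M - 1 \<and>
      (\<forall>l\<in>{..<M} - {m}. Isup N f M m - inverse (real (Suc n)) \<le> Irand N f m l Q)" for n
    by (rule ex_few_atoms_near_Isup) simp
  then obtain Q where Q: "\<And>n. Q n \<in> finite_pmfs (det_quantizers N)"
      "\<And>n. card (set_pmf (Q n)) \<le> M - 1"
    and Q_ge: "\<And>n l. l \<in> {..<M} - {m} \<Longrightarrow>
      Isup N f M m - inverse (real (Suc n)) \<le> Irand N f m l (Q n)"
    by metis
  obtain r P where r: "strict_mono r" and P: "P \<in> finite_pmfs C"
    "\<And>l. l \<in> {..<M} - {m} \<Longrightarrow> \<exists>L\<le>Irand N f m l P. (\<lambda>n. Irand N f m l (Q (r n))) \<longlonglongrightarrow> L"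
    using Irand_subseq_limit_le[OF C m, of Q, OF Q] by blast
  have "Isup N f M m \<le> Irand N f m l P" if l: "l \<in> {..<M} - {m}" for l
  proof -
    obtain L where L: "L \<le> Irand N f m l P" "(\<lambda>n. Irand N f m l (Q (r n))) \<longlonglongrightarrow> L"
      using P(2)[OF l] by blast
    have "(\<lambda>n. Isup N f M m - inverse (real (Suc n))) \<longlonglongrightarrow> Isup N f M m"
      using LIMSEQ_inverse_real_of_nat_add_minus[of "Isup N f M m"] by simp
    from LIMSEQ_subseq_LIMSEQ[OF this r] have "Isup N f M m \<le> L"
      by (rule LIMSEQ_le[OF _ L(2)]) (use Q_ge[OF l] in auto)
    with L(1) show ?thesis by simp
  qed
  with P(1) show ?thesis by blast
qed

lemma ex_maximin_few_atoms:
  assumes C: "generates_test_limits C"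
  shows "\<exists>Q\<in>finite_pmfs C. maximin N f M m Q \<and> card (set_pmf Q) \<le> M - 1"
proof -
  obtain P where P: "P \<in> finite_pmfs C"
    "\<And>l. l \<in> {..<M} - {m} \<Longrightarrow> Isup N f M m \<le> Irand N f m l P"
    using ex_finite_pmf_Irand_ge_Isup[OF C] by blast
  obtain Q where Q: "Q \<in> finite_pmfs (set_pmf P)" "card (set_pmf Q) \<le> M - 1"
    "\<And>l. l \<in> {..<M} - {m} \<Longrightarrow> Irand N f m l P \<le> Irand N f m l Q"
    using ex_few_atoms_Irand_ge[OF rand_quantizer_if_finite_pmf[OF C P(1)]] by blast
  have "Q \<in> finite_pmfs C"
    using P(1) Q(1) by (auto simp: finite_pmfs_def)
  moreover from this have "maximin N f M m Q"
    using P(2) Q(3) by (intro maximinI rand_quantizer_if_finite_pmf[OF C]) (auto intro: order_trans)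
  ultimately show ?thesis using Q(2) by blast
qed

end

end

theorem theorem4p3:
  fixes N :: "'a measure" and f :: "nat \<Rightarrow> 'a \<Rightarrow> real" and M :: nat
  assumes "sigma_finite_measure N"
    and "M \<ge> 2"
    and "\<forall>m<M. f m \<in> borel_measurable N"
    and "\<forall>m<M. \<forall>x\<in>space N. 0 \<le> f m x"
    and "\<forall>m<M. prob_space (Pm N f m)"
    and "\<forall>m<M. \<forall>m'<M. m \<noteq> m' \<longrightarrow>
           (AE x in Pm N f m. 0 < f m' x)
         \<and> integrable (Pm N f m) (\<lambda>x. ln (f m x / f m' x))
         \<and> 0 < (\<integral>x. ln (f m x / f m' x) \<partial>Pm N f m)"
    and "m < M"
  shows "(\<exists>Q. maximin N f M m Q \<and> finite (set_pmf Q) \<and> card (set_pmf Q) \<le> M - 1)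
       \<and> (lin_indep_dens N f M \<longrightarrow>
           (\<exists>Q. maximin N f M m Q \<and> finite (set_pmf Q) \<and> card (set_pmf Q) \<le> M - 1
                \<and> (\<forall>\<phi>\<in>set_pmf Q. ULQ N f M \<phi>)))"
proof -
  interpret observation_model N f M
    by (rule observation_model.intro) (use assms(3-6) in simp_all)
  have few_atoms: "\<exists>Q. maximin N f M m Q \<and> finite (set_pmf Q) \<and> card (set_pmf Q) \<le> M - 1 \<and>
    set_pmf Q \<subseteq> C" if "generates_test_limits C" for C
    using ex_maximin_few_atoms[OF assms(7,2) that] by (auto simp: finite_pmfs_def)
  show ?thesis
    using few_atoms[OF det_quantizers_generate_test_limits]
      few_atoms[OF ULQs_generate_test_limits] assms(2)
    by (auto simp: subset_iff)
qed

end
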